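(* Let $R$ be a noetherian ring with identity such that finitely generated left $R$-modules have unique minimal resolutions up to isomorphism (for example, a noetherian local ring), and let $M$ be a finitely generated left $R$-module. Then $M$ is indecomposable if and only if the relationship matrix $A_{\mathfrak{G},\mathfrak{R}}$ is inblockable for some minimal basis $\mathfrak{G}$ of $M$ and some relationship set $\mathfrak{R}$.
   Context: A module is indecomposable if it has no nontrivial direct sum decomposition. A minimal basis of a module is a minimal generating set. Let $\mathfrak{G}=\{g_1,\dots,g_v\}$ be a minimal basis of $M$, and let $F=\bigoplus_{j=1}^v Re_j$ be the associated free module with free basis $\{e_j\}$. The relationship submodule of $F$ is $\{\sum r_je_j\mid \sum r_jg_j=0\}$, and a relationship set $\mathfrak{R}$ is a set of generators of the relationship submodule. If $\mathfrak{R}$ has $u$ elements, the relationship matrix $A_{\mathfrak{G},\mathfrak{R}}=(a_{ij})_{u\times v}$ is the matrix whose rows $(a_{i1},\dots,a_{iv})$ correspond to the elements $\sum_j a_{ij}e_j$ of $\mathfrak{R}$. Two matrices $A$ and $A'$ of the same size over $R$ are equivalent, $A\sim A'$, if $A'=P\cdot A\cdot Q$ for invertible square matrices $P$ and $Q$ over $R$. A $u\times v$ matrix $A$ over $R$ has $t$ disjoint columns (blocks) if there are $t$ pairwise disjoint sets of columns, the $k$-th ($1\le k\le t$) consisting of $n_k>0$ columns of $A$, such that the nonzero rows of these $n_k$ columns (the rows in which at least one of these columns has a nonzero entry) have entries zero in all other $v-n_k$ columns. The maximal number of blocks is the block number $\mathrm{bn}(A)$. $A$ is blockable if it is equivalent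 to a matrix over $R$ with at least two blocks; otherwise $A$ is inblockable. *)

theory Defs
  imports
    "HOL-Algebra.AbelCoset"
    "HOL-Algebra.Module"
    "HOL-Library.Disjoint_Sets"
    "Jordan_Normal_Form.Matrix"
begin

section \<open>Left modules\<close>

text \<open>
  The library locale \<^locale>\<open>module\<close> requires a commutative ring of scalars.  The following is the
  same list of axioms over an arbitrary ring with identity.  The record type and the predicate
  \<^locale>\<open>submodule\<close> of the library involve no commutativity and are used unchanged.
\<close>

locale left_module = R?: ring R + M?: abelian_group M for R (structure) and M (structure) +
  assumes smult_closed [simp, intro]:
      "\<lbrakk>a \<in> carrier R; x \<in> carrier M\<rbrakk> \<Longrightarrow> a \<odot>\<^bsub>M\<^esub> x \<in> carrier M"
    and smult_l_distr:
      "\<lbrakk>a \<in> carrier R; b \<in> carrier R; x \<in> carrier M\<rbrakk> \<Longrightarrow>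
        (a \<oplus> b) \<odot>\<^bsub>M\<^esub> x = a \<odot>\<^bsub>M\<^esub> x \<oplus>\<^bsub>M\<^esub> b \<odot>\<^bsub>M\<^esub> x"
    and smult_r_distr:
      "\<lbrakk>a \<in> carrier R; x \<in> carrier M; y \<in> carrier M\<rbrakk> \<Longrightarrow>
        a \<odot>\<^bsub>M\<^esub> (x \<oplus>\<^bsub>M\<^esub> y) = a \<odot>\<^bsub>M\<^esub> x \<oplus>\<^bsub>M\<^esub> a \<odot>\<^bsub>M\<^esub> y"
    and smult_assoc1:
      "\<lbrakk>a \<in> carrier R; b \<in> carrier R; x \<in> carrier M\<rbrakk> \<Longrightarrow>
        (a \<otimes> b) \<odot>\<^bsub>M\<^esub> x = a \<odot>\<^bsub>M\<^esub> (b \<odot>\<^bsub>M\<^esub> x)"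
    and smult_one [simp]:
      "x \<in> carrier M \<Longrightarrow> \<one> \<odot>\<^bsub>M\<^esub> x = x"

definition module_span ::
  "('a, 'c) ring_scheme \<Rightarrow> ('a, 'b, 'd) module_scheme \<Rightarrow> 'b set \<Rightarrow> 'b set"
  where "module_span R M S = \<Inter> {H. submodule H R M \<and> S \<subseteq> H}"

definition generates ::
  "('a, 'c) ring_scheme \<Rightarrow> ('a, 'b, 'd) module_scheme \<Rightarrow> 'b set \<Rightarrow> 'b set \<Rightarrow> bool"
  where "generates R M H S \<longleftrightarrow> S \<subseteq> carrier M \<and> module_span R M S = H"

definition fin_gen ::
  "('a, 'c) ring_scheme \<Rightarrow> ('a, 'b, 'd) module_scheme \<Rightarrow> 'b set \<Rightarrow> bool"
  where "fin_gen R M H \<longleftrightarrow> (\<exists>S. finite S \<and> generates R M H S)"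

text \<open>
  A minimal basis of the submodule \<open>H\<close> of \<open>M\<close> is a generating set none of whose proper subsets
  generates \<open>H\<close>.  It comes as a repetition-free list, since the columns of the relationship matrix
  refer to an enumeration \<open>g\<^sub>1, \<dots>, g\<^sub>v\<close>.
\<close>

definition minimal_basis ::
  "('a, 'c) ring_scheme \<Rightarrow> ('a, 'b, 'd) module_scheme \<Rightarrow> 'b set \<Rightarrow> 'b list \<Rightarrow> bool"
  where "minimal_basis R M H gs \<longleftrightarrow>
    distinct gs \<and> generates R M H (set gs) \<and> (\<forall>S. S \<subset> set gs \<longrightarrow> \<not> generates R M H S)"

text \<open>The zero module counts as indecomposable: it has no nontrivial decomposition.\<close>

definition indecomposable ::
  "('a, 'c) ring_scheme \<Rightarrow> ('a, 'b, 'd) module_scheme \<Rightarrow> bool"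
  where "indecomposable R M \<longleftrightarrow>
    \<not> (\<exists>H K. submodule H R M \<and> submodule K R M \<and>
        H <+>\<^bsub>M\<^esub> K = carrier M \<and> H \<inter> K = {\<zero>\<^bsub>M\<^esub>} \<and> H \<noteq> {\<zero>\<^bsub>M\<^esub>} \<and> K \<noteq> {\<zero>\<^bsub>M\<^esub>})"

definition module_hom ::
  "('a, 'c) ring_scheme \<Rightarrow> ('a, 'b, 'd) module_scheme \<Rightarrow> ('a, 'e, 'f) module_scheme \<Rightarrow> ('b \<Rightarrow> 'e) set"
  where "module_hom R M N =
    {f \<in> hom (add_monoid M) (add_monoid N).
      \<forall>a \<in> carrier R. \<forall>x \<in> carrier M. f (a \<odot>\<^bsub>M\<^esub> x) = a \<odot>\<^bsub>N\<^esub> f x}"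

definition module_iso ::
  "('a, 'c) ring_scheme \<Rightarrow> ('a, 'b, 'd) module_scheme \<Rightarrow> ('a, 'e, 'f) module_scheme \<Rightarrow> ('b \<Rightarrow> 'e) set"
  where "module_iso R M N = {f \<in> module_hom R M N. bij_betw f (carrier M) (carrier N)}"


section \<open>Noetherian rings\<close>

definition regular_module :: "('a, 'c) ring_scheme \<Rightarrow> ('a, 'a) module"
  where "regular_module R =
    \<lparr>carrier = carrier R, monoid.mult = monoid.mult R, one = one R, zero = zero R, add = add R,
     smult = monoid.mult R\<rparr>"

text \<open>
  The submodules of the regular module are the left ideals.  The library locale
  \<open>noetherian_ring\<close> speaks about two-sided ideals only, which is too weak for left modules over a
  noncommutative ring.
\<close>

definition left_noetherian :: "('a, 'c) ring_scheme \<Rightarrow> bool"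
  where "left_noetherian R \<longleftrightarrow>
    (\<forall>I. submodule I R (regular_module R) \<longrightarrow> fin_gen R (regular_module R) I)"


section \<open>Finite free modules and minimal resolutions\<close>

text \<open>\<open>R\<^sup>n\<close>; the ring multiplication fields of the record play no role for modules.\<close>

definition free_module :: "('a, 'c) ring_scheme \<Rightarrow> nat \<Rightarrow> ('a, 'a vec) module"
  where "free_module R n =
    \<lparr>carrier = {x \<in> carrier_vec n. \<forall>i<n. x $ i \<in> carrier R},
     monoid.mult = undefined, one = undefined,
     zero = vec n (\<lambda>i. \<zero>\<^bsub>R\<^esub>),
     add = (\<lambda>x y. vec n (\<lambda>i. x $ i \<oplus>\<^bsub>R\<^esub> y $ i)),
     smult = (\<lambda>a x. vec n (\<lambda>i. a \<otimes>\<^bsub>R\<^esub> x $ i))\<rparr>"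

definition free_basis :: "('a, 'c) ring_scheme \<Rightarrow> nat \<Rightarrow> 'a vec list"
  where "free_basis R n = map (\<lambda>j. vec n (\<lambda>i. if i = j then \<one>\<^bsub>R\<^esub> else \<zero>\<^bsub>R\<^esub>)) [0..<n]"

text \<open>
  An exact sequence \<open>\<dots> \<rightarrow> R\<^bsup>n\<^sub>1\<^esup> \<rightarrow> R\<^bsup>n\<^sub>0\<^esup> \<rightarrow> M \<rightarrow> 0\<close>
  with augmentation \<open>e : R\<^bsup>n\<^sub>0\<^esup> \<rightarrow> M\<close> and differentials \<open>d i : R\<^bsup>n\<^sub>i\<^sub>+\<^sub>1\<^esup> \<rightarrow> R\<^bsup>n\<^sub>i\<^esup>\<close>
  is a minimal resolution if each of these maps sends the free basis of its source bijectively onto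
  a minimal basis of its image.  Over a left noetherian ring, all terms of a minimal resolution of
  a finitely generated module have finite rank.
\<close>

definition minimal_resolution ::
  "('a, 'c) ring_scheme \<Rightarrow> ('a, 'b, 'd) module_scheme \<Rightarrow>
    (nat \<Rightarrow> nat) \<Rightarrow> ('a vec \<Rightarrow> 'b) \<Rightarrow> (nat \<Rightarrow> 'a vec \<Rightarrow> 'a vec) \<Rightarrow> bool"
  where "minimal_resolution R M n e d \<longleftrightarrow>
    e \<in> module_hom R (free_module R (n 0)) M \<and>
    (\<forall>i. d i \<in> module_hom R (free_module R (n (Suc i))) (free_module R (n i))) \<and>
    e ` carrier (free_module R (n 0)) = carrier M \<and>
    d 0 ` carrier (free_module R (n 1)) =
      {x \<in> carrier (free_module R (n 0)). e x = \<zero>\<^bsub>M\<^esub>} \<and>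
    (\<forall>i. d (Suc i) ` carrier (free_module R (n (Suc (Suc i)))) =
      {x \<in> carrier (free_module R (n (Suc i))). d i x = \<zero>\<^bsub>free_module R (n i)\<^esub>}) \<and>
    minimal_basis R M (carrier M) (map e (free_basis R (n 0))) \<and>
    (\<forall>i. minimal_basis R (free_module R (n i)) (d i ` carrier (free_module R (n (Suc i))))
      (map (d i) (free_basis R (n (Suc i)))))"

text \<open>Isomorphism of complexes over the identity of \<open>M\<close>.\<close>

definition isomorphic_resolutions ::
  "('a, 'c) ring_scheme \<Rightarrow>
    (nat \<Rightarrow> nat) \<Rightarrow> ('a vec \<Rightarrow> 'b) \<Rightarrow> (nat \<Rightarrow> 'a vec \<Rightarrow> 'a vec) \<Rightarrow>
    (nat \<Rightarrow> nat) \<Rightarrow> ('a vec \<Rightarrow> 'b) \<Rightarrow> (nat \<Rightarrow> 'a vec \<Rightarrow> 'a vec) \<Rightarrow> bool"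
  where "isomorphic_resolutions R n e d n' e' d' \<longleftrightarrow>
    (\<exists>f. (\<forall>i. f i \<in> module_iso R (free_module R (n i)) (free_module R (n' i))) \<and>
      (\<forall>x \<in> carrier (free_module R (n 0)). e' (f 0 x) = e x) \<and>
      (\<forall>i. \<forall>x \<in> carrier (free_module R (n (Suc i))). d' i (f (Suc i) x) = f i (d i x)))"

text \<open>
  Every finitely generated left \<open>R\<close>-module is isomorphic to a quotient of some \<open>R\<^sup>n\<close>, that is, to a
  module whose elements are sets of vectors over \<open>R\<close>.  Hence quantifying over modules with carrier
  in \<^typ>\<open>'a vec set\<close> covers all finitely generated left \<open>R\<close>-modules up to isomorphism.
\<close>

definition unique_minimal_resolutions :: "('a, 'c) ring_scheme \<Rightarrow> bool"
  where "unique_minimal_resolutions R \<longleftrightarrow>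
    (\<forall>N :: ('a, 'a vec set) module. left_module R N \<and> fin_gen R N (carrier N) \<longrightarrow>
      (\<exists>n e d. minimal_resolution R N n e d) \<and>
      (\<forall>n e d n' e' d'. minimal_resolution R N n e d \<and> minimal_resolution R N n' e' d' \<longrightarrow>
        isomorphic_resolutions R n e d n' e' d'))"


section \<open>Relationship matrices\<close>

definition relationship_submodule ::
  "('a, 'c) ring_scheme \<Rightarrow> ('a, 'b, 'd) module_scheme \<Rightarrow> 'b list \<Rightarrow> 'a vec set"
  where "relationship_submodule R M gs =
    {r \<in> carrier (free_module R (length gs)).
      (\<Oplus>\<^bsub>M\<^esub>j\<in>{..<length gs}. (r $ j) \<odot>\<^bsub>M\<^esub> (gs ! j)) = \<zero>\<^bsub>M\<^esub>}"

text \<open>A relationship set is any finite generating set, not necessarily a minimal one.\<close>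

definition relationship_set ::
  "('a, 'c) ring_scheme \<Rightarrow> ('a, 'b, 'd) module_scheme \<Rightarrow> 'b list \<Rightarrow> 'a vec list \<Rightarrow> bool"
  where "relationship_set R M gs rs \<longleftrightarrow>
    distinct rs \<and>
    generates R (free_module R (length gs)) (relationship_submodule R M gs) (set rs)"

definition relationship_matrix :: "'b list \<Rightarrow> 'a vec list \<Rightarrow> 'a mat"
  where "relationship_matrix gs rs = mat_of_rows (length gs) rs"


section \<open>Equivalence and blocks of matrices\<close>

text \<open>
  Matrix arithmetic of the library is tied to type classes.  Only its matrix type is used here,
  with the product taken in the ring \<open>R\<close>.
\<close>

definition matrices :: "('a, 'c) ring_scheme \<Rightarrow> nat \<Rightarrow> nat \<Rightarrow> 'a mat set"
  where "matrices R u v =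
    {A \<in> carrier_mat u v. \<forall>i<u. \<forall>j<v. A $$ (i, j) \<in> carrier R}"

definition matrix_mult :: "('a, 'c) ring_scheme \<Rightarrow> 'a mat \<Rightarrow> 'a mat \<Rightarrow> 'a mat"
  where "matrix_mult R A B =
    mat (dim_row A) (dim_col B)
      (\<lambda>(i, j). \<Oplus>\<^bsub>R\<^esub>k\<in>{..<dim_col A}. A $$ (i, k) \<otimes>\<^bsub>R\<^esub> B $$ (k, j))"

definition identity_matrix :: "('a, 'c) ring_scheme \<Rightarrow> nat \<Rightarrow> 'a mat"
  where "identity_matrix R n = mat n n (\<lambda>(i, j). if i = j then \<one>\<^bsub>R\<^esub> else \<zero>\<^bsub>R\<^esub>)"

definition invertible_matrices :: "('a, 'c) ring_scheme \<Rightarrow> nat \<Rightarrow> 'a mat set"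
  where "invertible_matrices R n =
    {P \<in> matrices R n n. \<exists>P' \<in> matrices R n n.
      matrix_mult R P P' = identity_matrix R n \<and> matrix_mult R P' P = identity_matrix R n}"

definition equivalent_matrices :: "('a, 'c) ring_scheme \<Rightarrow> 'a mat \<Rightarrow> 'a mat \<Rightarrow> bool"
  where "equivalent_matrices R A A' \<longleftrightarrow>
    (\<exists>u v. A \<in> matrices R u v \<and> A' \<in> matrices R u v \<and>
      (\<exists>P \<in> invertible_matrices R u. \<exists>Q \<in> invertible_matrices R v.
        A' = matrix_mult R (matrix_mult R P A) Q))"

definition is_block :: "('a, 'c) ring_scheme \<Rightarrow> 'a mat \<Rightarrow> nat set \<Rightarrow> bool"
  where "is_block R A C \<longleftrightarrow>
    C \<noteq> {} \<and> C \<subseteq> {..<dim_col A} \<and>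
    (\<forall>i<dim_row A. (\<exists>j\<in>C. A $$ (i, j) \<noteq> \<zero>\<^bsub>R\<^esub>) \<longrightarrow>
      (\<forall>j\<in>{..<dim_col A} - C. A $$ (i, j) = \<zero>\<^bsub>R\<^esub>))"

definition has_disjoint_blocks :: "('a, 'c) ring_scheme \<Rightarrow> 'a mat \<Rightarrow> nat \<Rightarrow> bool"
  where "has_disjoint_blocks R A t \<longleftrightarrow>
    (\<exists>C. disjoint_family_on C {..<t} \<and> (\<forall>k<t. is_block R A (C k)))"

text \<open>
  The set is nonempty, as it contains \<open>0\<close>, and bounded by the number of columns.  A matrix without
  columns has block number \<open>0\<close>.
\<close>

definition block_number :: "('a, 'c) ring_scheme \<Rightarrow> 'a mat \<Rightarrow> nat"
  where "block_number R A = Max {t. has_disjoint_blocks R A t}"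

definition blockable :: "('a, 'c) ring_scheme \<Rightarrow> 'a mat \<Rightarrow> bool"
  where "blockable R A \<longleftrightarrow> (\<exists>B. equivalent_matrices R A B \<and> block_number R B \<ge> 2)"

definition inblockable :: "('a, 'c) ring_scheme \<Rightarrow> 'a mat \<Rightarrow> bool"
  where "inblockable R A \<longleftrightarrow> \<not> blockable R A"

end

theory Submission
  imports Defs
begin

text \<open>
  Let the rows of a matrix \<open>A\<close> generate the relations of a generating family \<open>x\<close> of \<open>M\<close>.  Replacing
  \<open>A\<close> by \<open>P A Q\<close> with invertible \<open>P\<close> and \<open>Q\<close> replaces \<open>x\<close> by the family \<open>Q\<^sup>-\<^sup>1 x\<close> and the generating
  relations by other ones, so equivalent matrices describe the same module in different generators
  (\<open>relation_matrix_base_change\<close>, \<open>relation_matrix_row_change\<close>).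
  
  A block \<open>C\<close> of a relation matrix of \<open>z\<close> splits every relation of \<open>z\<close> into a relation among the \<open>z j\<close>
  with \<open>j \<in> C\<close> and one among the others, hence \<open>M\<close> is the direct sum of the submodules generated by
  these two parts of \<open>z\<close> (\<open>block_imp_decomposable\<close>).  Both are nonzero if \<open>M\<close> cannot be generated by
  fewer elements than \<open>z\<close> has.  So for an indecomposable module a minimal basis of least cardinality
  has only inblockable relationship matrices.
  
  For the converse let \<open>M = H \<oplus> K\<close> be a nontrivial decomposition, \<open>x\<close> a generating family and \<open>A\<close> a
  matrix whose rows generate the relations of \<open>x\<close>.  Uniqueness of minimal resolutions forces the ring
  to be local (\<open>left_local_if_unique_minimal_resolutions\<close>): were \<open>a + b = 1\<close> with neither summand left
  invertible, then \<open>(1)\<close> and \<open>(a, b)\<close> would both be minimal bases of the left module \<open>R\<close>, and an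
  isomorphism of their resolutions would make \<open>(r, s) \<mapsto> r a + s b\<close> injective, although it sends
  \<open>(b, - a)\<close> to \<open>0\<close>.  Over a local ring the exchange argument applies to arbitrary
  generating families: given any finite generating set \<open>S\<close>, an invertible matrix turns a generating
  family into one with values in \<open>S \<union> {0}\<close> (\<open>exchange_generators\<close>).  Used for \<open>x\<close> and a generating set
  contained in \<open>H \<union> K\<close>, it yields a matrix \<open>Q\<close> such that the rows of \<open>A Q\<close> generate relations between
  elements of \<open>H\<close> and elements of \<open>K\<close>.  Such a relation is the sum of its \<open>H\<close>-part and its \<open>K\<close>-part, which are
  relations as well.  Used once more, for the rows of \<open>A Q\<close> and the set of these parts, it yields a
  matrix \<open>P\<close> such that every row of \<open>P A Q\<close> is supported on one side: \<open>P A Q\<close> has two blocks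
  (\<open>decomposable_imp_blockable\<close>).
\<close>

section \<open>Linear combinations\<close>

text \<open>
  Families are functions on all natural numbers, of which only the values below \<open>n\<close> matter.  This
  lets rows and columns of matrices, lists and vectors all serve as families.
\<close>

definition lincomb :: "('a, 'b, 'd) module_scheme \<Rightarrow> nat \<Rightarrow> (nat \<Rightarrow> 'a) \<Rightarrow> (nat \<Rightarrow> 'b) \<Rightarrow> 'b"
  where "lincomb M n r x = (\<Oplus>\<^bsub>M\<^esub>k\<in>{..<n}. r k \<odot>\<^bsub>M\<^esub> x k)"

context left_module
begin

lemma smult_l_null [simp]:
  assumes "x \<in> carrier M" shows "\<zero> \<odot>\<^bsub>M\<^esub> x = \<zero>\<^bsub>M\<^esub>"
proof -
  have "\<zero> \<odot>\<^bsub>M\<^esub> x \<oplus>\<^bsub>M\<^esub> \<zero> \<odot>\<^bsub>M\<^esub> x = \<zero> \<odot>\<^bsub>M\<^esub> x"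
    using smult_l_distr[of \<zero> \<zero> x] assms by simp
  then show ?thesis
    using assms M.add.r_cancel_one by blast
qed

lemma smult_r_null [simp]:
  assumes "a \<in> carrier R" shows "a \<odot>\<^bsub>M\<^esub> \<zero>\<^bsub>M\<^esub> = \<zero>\<^bsub>M\<^esub>"
proof -
  have "a \<odot>\<^bsub>M\<^esub> \<zero>\<^bsub>M\<^esub> \<oplus>\<^bsub>M\<^esub> a \<odot>\<^bsub>M\<^esub> \<zero>\<^bsub>M\<^esub> = a \<odot>\<^bsub>M\<^esub> \<zero>\<^bsub>M\<^esub>"
    using smult_r_distr[of a "\<zero>\<^bsub>M\<^esub>" "\<zero>\<^bsub>M\<^esub>"] assms by simp
  then show ?thesis
    using assms M.add.r_cancel_one by blast
qed

lemma smult_l_minus: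
  assumes "a \<in> carrier R" "x \<in> carrier M"
  shows "(\<ominus> a) \<odot>\<^bsub>M\<^esub> x = \<ominus>\<^bsub>M\<^esub> (a \<odot>\<^bsub>M\<^esub> x)"
proof -
  have "(\<ominus> a) \<odot>\<^bsub>M\<^esub> x \<oplus>\<^bsub>M\<^esub> a \<odot>\<^bsub>M\<^esub> x = \<zero>\<^bsub>M\<^esub>"
    using smult_l_distr[of "\<ominus> a" a x] assms by (simp add: R.l_neg)
  then show ?thesis
    using assms by (metis M.minus_equality R.a_inv_closed smult_closed)
qed

lemma lincomb_0 [simp]: "lincomb M 0 r x = \<zero>\<^bsub>M\<^esub>"
  by (simp add: lincomb_def)

lemma lincomb_Suc [simp]:
  assumes "\<And>k. k < Suc n \<Longrightarrow> r k \<in> carrier R" "\<And>k. k < Suc n \<Longrightarrow> x k \<in> carrier M"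
  shows "lincomb M (Suc n) r x = r n \<odot>\<^bsub>M\<^esub> x n \<oplus>\<^bsub>M\<^esub> lincomb M n r x"
  unfolding lincomb_def lessThan_Suc using assms by (subst M.finsum_insert) auto

lemma lincomb_closed [simp]:
  assumes "\<And>k. k < n \<Longrightarrow> r k \<in> carrier R" "\<And>k. k < n \<Longrightarrow> x k \<in> carrier M"
  shows "lincomb M n r x \<in> carrier M"
  unfolding lincomb_def using assms by (intro M.finsum_closed) auto

lemma lincomb_1:
  assumes "r 0 \<in> carrier R" "x 0 \<in> carrier M"
  shows "lincomb M (Suc 0) r x = r 0 \<odot>\<^bsub>M\<^esub> x 0"
  using lincomb_Suc[of 0 r x] assms by simp

lemma lincomb_2:
  assumes "r 0 \<in> carrier R" "r (Suc 0) \<in> carrier R" "x 0 \<in> carrier M" "x (Suc 0) \<in> carrier M"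
  shows "lincomb M (Suc (Suc 0)) r x = r (Suc 0) \<odot>\<^bsub>M\<^esub> x (Suc 0) \<oplus>\<^bsub>M\<^esub> r 0 \<odot>\<^bsub>M\<^esub> x 0"
proof -
  have "r k \<in> carrier R" "x k \<in> carrier M" if "k < Suc (Suc 0)" for k
    using that assms by (auto simp: less_Suc_eq)
  then show ?thesis
    using lincomb_Suc[of "Suc 0" r x] assms by (simp add: lincomb_1)
qed

lemma lincomb_cong:
  assumes "\<And>k. k < n \<Longrightarrow> s k \<in> carrier R" "\<And>k. k < n \<Longrightarrow> y k \<in> carrier M"
    and "\<And>k. k < n \<Longrightarrow> r k = s k" "\<And>k. k < n \<Longrightarrow> x k = y k"
  shows "lincomb M n r x = lincomb M n s y"
  unfolding lincomb_def using assms by (intro M.finsum_cong') auto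

lemma lincomb_add:
  assumes "\<And>k. k < n \<Longrightarrow> r k \<in> carrier R" "\<And>k. k < n \<Longrightarrow> s k \<in> carrier R"
    and "\<And>k. k < n \<Longrightarrow> x k \<in> carrier M"
  shows "lincomb M n (\<lambda>k. r k \<oplus> s k) x = lincomb M n r x \<oplus>\<^bsub>M\<^esub> lincomb M n s x"
proof -
  have "lincomb M n (\<lambda>k. r k \<oplus> s k) x = (\<Oplus>\<^bsub>M\<^esub>k\<in>{..<n}. r k \<odot>\<^bsub>M\<^esub> x k \<oplus>\<^bsub>M\<^esub> s k \<odot>\<^bsub>M\<^esub> x k)"
    unfolding lincomb_def using assms by (intro M.finsum_cong') (auto simp: smult_l_distr)
  then show ?thesis
    unfolding lincomb_def using assms by (subst (asm) M.finsum_addf) auto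
qed

lemma lincomb_add_vectors:
  assumes "\<And>k. k < n \<Longrightarrow> r k \<in> carrier R" "\<And>k. k < n \<Longrightarrow> x k \<in> carrier M"
    and "\<And>k. k < n \<Longrightarrow> y k \<in> carrier M"
  shows "lincomb M n r (\<lambda>k. x k \<oplus>\<^bsub>M\<^esub> y k) = lincomb M n r x \<oplus>\<^bsub>M\<^esub> lincomb M n r y"
proof -
  have "lincomb M n r (\<lambda>k. x k \<oplus>\<^bsub>M\<^esub> y k) = (\<Oplus>\<^bsub>M\<^esub>k\<in>{..<n}. r k \<odot>\<^bsub>M\<^esub> x k \<oplus>\<^bsub>M\<^esub> r k \<odot>\<^bsub>M\<^esub> y k)"
    unfolding lincomb_def using assms by (intro M.finsum_cong') (auto simp: smult_r_distr)
  then show ?thesis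
    unfolding lincomb_def using assms by (subst (asm) M.finsum_addf) auto
qed

lemma lincomb_smult:
  assumes "a \<in> carrier R" "\<And>k. k < n \<Longrightarrow> r k \<in> carrier R" "\<And>k. k < n \<Longrightarrow> x k \<in> carrier M"
  shows "lincomb M n (\<lambda>k. a \<otimes> r k) x = a \<odot>\<^bsub>M\<^esub> lincomb M n r x"
  using assms(2,3)
  by (induction n) (use assms(1) in \<open>simp_all add: smult_assoc1 smult_r_distr\<close>)

lemma lincomb_eq_zero:
  assumes "\<And>k. k < n \<Longrightarrow> r k \<odot>\<^bsub>M\<^esub> x k = \<zero>\<^bsub>M\<^esub>"
  shows "lincomb M n r x = \<zero>\<^bsub>M\<^esub>"
  unfolding lincomb_def using assms by (intro M.add.finprod_one_eqI) auto

lemma lincomb_minus: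
  assumes "\<And>k. k < n \<Longrightarrow> r k \<in> carrier R" "\<And>k. k < n \<Longrightarrow> x k \<in> carrier M"
  shows "lincomb M n (\<lambda>k. \<ominus> r k) x = \<ominus>\<^bsub>M\<^esub> lincomb M n r x"
  using assms
proof (induction n)
  case 0
  show ?case
    by (simp add: a_inv_def)
qed (simp_all add: smult_l_minus M.minus_add)

lemma lincomb_single:
  assumes "i < n" "a \<in> carrier R" "\<And>k. k < n \<Longrightarrow> x k \<in> carrier M"
  shows "lincomb M n (\<lambda>k. if k = i then a else \<zero>) x = a \<odot>\<^bsub>M\<^esub> x i"
proof -
  have "lincomb M n (\<lambda>k. if k = i then a else \<zero>) x
      = (\<Oplus>\<^bsub>M\<^esub>k\<in>{..<n}. if i = k then a \<odot>\<^bsub>M\<^esub> x k else \<zero>\<^bsub>M\<^esub>)"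
    unfolding lincomb_def using assms by (intro M.finsum_cong') auto
  then show ?thesis
    using assms M.finsum_singleton[of i "{..<n}" "\<lambda>k. a \<odot>\<^bsub>M\<^esub> x k"] by auto
qed

lemma lincomb_unit:
  assumes "i < n" "\<And>k. k < n \<Longrightarrow> x k \<in> carrier M"
  shows "lincomb M n (\<lambda>k. if k = i then \<one> else \<zero>) x = x i"
  using lincomb_single[of i n \<one> x] assms by simp

lemma lincomb_split_at:
  assumes "i < n" "\<And>k. k < n \<Longrightarrow> r k \<in> carrier R" "\<And>k. k < n \<Longrightarrow> x k \<in> carrier M"
  shows "lincomb M n r x = r i \<odot>\<^bsub>M\<^esub> x i \<oplus>\<^bsub>M\<^esub> lincomb M n (\<lambda>k. if k = i then \<zero> else r k) x"
proof -
  have "lincomb M n r x = lincomb M n (\<lambda>k. (if k = i then r i else \<zero>) \<oplus> (if k = i then \<zero> else r k)) x"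
    using assms by (intro lincomb_cong) auto
  then show ?thesis
    using assms by (simp add: lincomb_add lincomb_single)
qed

end

lemma regular_module_simps [simp]:
  "carrier (regular_module R) = carrier R"
  "\<zero>\<^bsub>regular_module R\<^esub> = \<zero>\<^bsub>R\<^esub>"
  "x \<oplus>\<^bsub>regular_module R\<^esub> y = x \<oplus>\<^bsub>R\<^esub> y"
  "a \<odot>\<^bsub>regular_module R\<^esub> x = a \<otimes>\<^bsub>R\<^esub> x"
  by (simp_all add: regular_module_def)

lemma left_module_regular:
  assumes "ring R" shows "left_module R (regular_module R)"
proof -
  interpret ring R by fact
  have "abelian_group (regular_module R)"
  proof (rule abelian_groupI)
    fix x assume "x \<in> carrier (regular_module R)"
    then show "\<exists>y\<in>carrier (regular_module R). y \<oplus>\<^bsub>regular_module R\<^esub> x = \<zero>\<^bsub>regular_module R\<^esub>"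
      using l_neg by auto
  qed (auto simp: a_ac)
  then show ?thesis
    using ring_axioms
    by (intro left_module.intro left_module_axioms.intro) (auto simp: m_assoc l_distr r_distr)
qed

context left_module
begin

text \<open>
  Interchange of summation.  Taken in the regular module it gives associativity of matrix
  multiplication; taken in \<open>M\<close> it says that matrices act on families.
\<close>

lemma lincomb_lincomb:
  assumes "\<And>j. j < m \<Longrightarrow> s j \<in> carrier R"
    and "\<And>j k. j < m \<Longrightarrow> k < n \<Longrightarrow> A j k \<in> carrier R"
    and "\<And>k. k < n \<Longrightarrow> x k \<in> carrier M"
  shows "lincomb M m s (\<lambda>j. lincomb M n (A j) x)
    = lincomb M n (\<lambda>k. lincomb (regular_module R) m s (\<lambda>j. A j k)) x"
proof -
  interpret Reg: left_module R "regular_module R"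
    by (rule left_module_regular) (rule R.ring_axioms)
  show ?thesis
    using assms(1,2)
  proof (induction m)
    case 0
    then show ?case
      using assms(3) by (simp add: lincomb_eq_zero)
  next
    case (Suc m)
    have c: "lincomb (regular_module R) m s (\<lambda>j. A j k) \<in> carrier R" if "k < n" for k
      using Reg.lincomb_closed[of m s "\<lambda>j. A j k"] Suc.prems that by simp
    have "lincomb M (Suc m) s (\<lambda>j. lincomb M n (A j) x)
        = s m \<odot>\<^bsub>M\<^esub> lincomb M n (A m) x
          \<oplus>\<^bsub>M\<^esub> lincomb M n (\<lambda>k. lincomb (regular_module R) m s (\<lambda>j. A j k)) x"
      using Suc assms(3) by simp
    also have "\<dots> = lincomb M n (\<lambda>k. s m \<otimes> A m k \<oplus> lincomb (regular_module R) m s (\<lambda>j. A j k)) x"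
      using Suc.prems assms(3) c by (simp add: lincomb_add lincomb_smult)
    also have "\<dots> = lincomb M n (\<lambda>k. lincomb (regular_module R) (Suc m) s (\<lambda>j. A j k)) x"
      using Suc.prems assms(3) c Reg.lincomb_Suc by (intro lincomb_cong) auto
    finally show ?case .
  qed
qed

end

section \<open>Submodules and spans\<close>

context left_module
begin

lemma submoduleI:
  assumes "H \<subseteq> carrier M" "\<zero>\<^bsub>M\<^esub> \<in> H"
    and "\<And>x y. x \<in> H \<Longrightarrow> y \<in> H \<Longrightarrow> x \<oplus>\<^bsub>M\<^esub> y \<in> H"
    and "\<And>a x. a \<in> carrier R \<Longrightarrow> x \<in> H \<Longrightarrow> a \<odot>\<^bsub>M\<^esub> x \<in> H"
  shows "submodule H R M"
proof (intro submodule.intro submodule_axioms.intro group.subgroupI[OF M.a_group])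
  fix x assume x: "x \<in> H"
  then have "\<ominus>\<^bsub>M\<^esub> x = (\<ominus> \<one>) \<odot>\<^bsub>M\<^esub> x"
    using assms(1) by (subst smult_l_minus) auto
  then show "inv\<^bsub>add_monoid M\<^esub> x \<in> H"
    using assms(4)[of "\<ominus> \<one>" x] x by (simp add: a_inv_def)
qed (use assms in auto)

lemma submodule_facts:
  assumes "submodule H R M"
  shows submodule_subset: "H \<subseteq> carrier M"
    and submodule_zero: "\<zero>\<^bsub>M\<^esub> \<in> H"
    and submodule_add: "\<And>x y. x \<in> H \<Longrightarrow> y \<in> H \<Longrightarrow> x \<oplus>\<^bsub>M\<^esub> y \<in> H"
    and submodule_smult: "\<And>a x. a \<in> carrier R \<Longrightarrow> x \<in> H \<Longrightarrow> a \<odot>\<^bsub>M\<^esub> x \<in> H"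
    and submodule_neg: "\<And>x. x \<in> H \<Longrightarrow> \<ominus>\<^bsub>M\<^esub> x \<in> H"
proof -
  interpret submodule H R M by fact
  show "H \<subseteq> carrier M" "\<zero>\<^bsub>M\<^esub> \<in> H"
    "\<And>x y. x \<in> H \<Longrightarrow> y \<in> H \<Longrightarrow> x \<oplus>\<^bsub>M\<^esub> y \<in> H"
    "\<And>a x. a \<in> carrier R \<Longrightarrow> x \<in> H \<Longrightarrow> a \<odot>\<^bsub>M\<^esub> x \<in> H"
    "\<And>x. x \<in> H \<Longrightarrow> \<ominus>\<^bsub>M\<^esub> x \<in> H"
    using subset one_closed m_closed smult_closed m_inv_closed by (auto simp: a_inv_def)
qed

lemma submodule_lincomb:
  assumes "submodule H R M"
    and "\<And>k. k < n \<Longrightarrow> r k \<in> carrier R" "\<And>k. k < n \<Longrightarrow> x k \<in> H"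
  shows "lincomb M n r x \<in> H"
proof -
  note H = submodule_facts[OF assms(1)]
  show ?thesis
    using assms(2,3)
  proof (induction n)
    case (Suc n)
    then have "lincomb M (Suc n) r x = r n \<odot>\<^bsub>M\<^esub> x n \<oplus>\<^bsub>M\<^esub> lincomb M n r x"
      using H(1) by (intro lincomb_Suc) auto
    then show ?case
      using Suc H by simp
  qed (use H in simp)
qed

lemma submodule_carrier: "submodule (carrier M) R M"
  by (rule submoduleI) auto

lemma span_superset: "S \<subseteq> module_span R M S"
  by (auto simp: module_span_def)

lemma span_least:
  assumes "submodule H R M" "S \<subseteq> H" shows "module_span R M S \<subseteq> H"
  using assms by (auto simp: module_span_def)

lemma submodule_span:
  assumes "S \<subseteq> carrier M" shows "submodule (module_span R M S) R M"
proof (rule submoduleI)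
  show "module_span R M S \<subseteq> carrier M"
    using span_least[OF submodule_carrier assms] .
qed (auto simp: module_span_def intro: submodule_facts)

lemma span_subset_span:
  assumes "T \<subseteq> carrier M" "S \<subseteq> module_span R M T"
  shows "module_span R M S \<subseteq> module_span R M T"
  using span_least[OF submodule_span] assms by auto

lemma span_mono:
  assumes "T \<subseteq> carrier M" "S \<subseteq> T"
  shows "module_span R M S \<subseteq> module_span R M T"
  using span_subset_span[OF assms(1)] span_superset assms(2) by blast

text \<open>
  For \<open>C\<close> the whole index set this gives the span of the family; for a block \<open>C\<close> of a relation
  matrix it gives a direct summand.
\<close>

lemma submodule_lincombs_supported:
  assumes "\<And>k. k < n \<Longrightarrow> x k \<in> carrier M"
  shows "submodule {lincomb M n r x | r. \<forall>k<n. r k \<in> carrier R \<and> (k \<notin> C \<longrightarrow> r k = \<zero>)} R M"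
    (is "submodule ?H R M")
proof (rule submoduleI)
  show "?H \<subseteq> carrier M"
    using assms by auto
  have "lincomb M n (\<lambda>k. \<zero>) x = \<zero>\<^bsub>M\<^esub>"
    using assms by (intro lincomb_eq_zero) auto
  then show "\<zero>\<^bsub>M\<^esub> \<in> ?H"
    by (intro CollectI exI[of _ "\<lambda>k. \<zero>"]) auto
  fix u assume "u \<in> ?H"
  then obtain r where r: "u = lincomb M n r x"
    "\<And>k. k < n \<Longrightarrow> r k \<in> carrier R" "\<And>k. k < n \<Longrightarrow> k \<notin> C \<Longrightarrow> r k = \<zero>"
    by blast
  show "u \<oplus>\<^bsub>M\<^esub> v \<in> ?H" if "v \<in> ?H" for v
  proof -
    from that obtain s where s: "v = lincomb M n s x"
      "\<And>k. k < n \<Longrightarrow> s k \<in> carrier R" "\<And>k. k < n \<Longrightarrow> k \<notin> C \<Longrightarrow> s k = \<zero>"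
      by blast
    have "u \<oplus>\<^bsub>M\<^esub> v = lincomb M n (\<lambda>k. r k \<oplus> s k) x"
      using r s assms by (simp add: lincomb_add)
    then show ?thesis
      using r s by (intro CollectI exI[of _ "\<lambda>k. r k \<oplus> s k"]) auto
  qed
  show "a \<odot>\<^bsub>M\<^esub> u \<in> ?H" if "a \<in> carrier R" for a
  proof -
    have "a \<odot>\<^bsub>M\<^esub> u = lincomb M n (\<lambda>k. a \<otimes> r k) x"
      using r assms that by (simp add: lincomb_smult)
    then show ?thesis
      using r that by (intro CollectI exI[of _ "\<lambda>k. a \<otimes> r k"]) auto
  qed
qed

lemma span_family:
  assumes "\<And>k. k < n \<Longrightarrow> x k \<in> carrier M"
  shows "module_span R M (x ` {..<n}) = {lincomb M n r x | r. \<forall>k<n. r k \<in> carrier R}"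
    (is "?S = ?H")
proof
  have "submodule ?H R M"
    using submodule_lincombs_supported[OF assms, where C = UNIV] by simp
  moreover have "x ` {..<n} \<subseteq> ?H"
  proof
    fix y assume "y \<in> x ` {..<n}"
    then obtain i where "i < n" "y = x i"
      by auto
    then show "y \<in> ?H"
      using lincomb_unit[of i n x] assms
      by (intro CollectI exI[of _ "\<lambda>k. if k = i then \<one> else \<zero>"]) auto
  qed
  ultimately show "?S \<subseteq> ?H"
    by (rule span_least)
  have "submodule ?S R M"
    using assms by (intro submodule_span) auto
  moreover have "x k \<in> ?S" if "k < n" for k
    using that span_superset[of "x ` {..<n}"] by blast
  ultimately show "?H \<subseteq> ?S"
    by (auto intro: submodule_lincomb)
qed

lemma span_insert:
  assumes "y \<in> carrier M" "S \<subseteq> carrier M" "w \<in> module_span R M (insert y S)"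
  obtains c w' where "c \<in> carrier R" "w' \<in> module_span R M S" "w = c \<odot>\<^bsub>M\<^esub> y \<oplus>\<^bsub>M\<^esub> w'"
proof -
  let ?W = "module_span R M S"
  let ?H = "{c \<odot>\<^bsub>M\<^esub> y \<oplus>\<^bsub>M\<^esub> w' | c w'. c \<in> carrier R \<and> w' \<in> ?W}"
  note W = submodule_facts[OF submodule_span[OF assms(2)]]
  have Wc: "w' \<in> carrier M" if "w' \<in> ?W" for w'
    using that W(1) by blast
  have "submodule ?H R M"
  proof (rule submoduleI)
    show "?H \<subseteq> carrier M"
      using Wc assms(1) by auto
    have "\<zero>\<^bsub>M\<^esub> = \<zero> \<odot>\<^bsub>M\<^esub> y \<oplus>\<^bsub>M\<^esub> \<zero>\<^bsub>M\<^esub>"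
      using assms(1) by simp
    then show "\<zero>\<^bsub>M\<^esub> \<in> ?H"
      using W(2) by blast
  next
    fix u v assume "u \<in> ?H" "v \<in> ?H"
    then obtain a p b q where "a \<in> carrier R" "p \<in> ?W" "u = a \<odot>\<^bsub>M\<^esub> y \<oplus>\<^bsub>M\<^esub> p"
      "b \<in> carrier R" "q \<in> ?W" "v = b \<odot>\<^bsub>M\<^esub> y \<oplus>\<^bsub>M\<^esub> q"
      by blast
    moreover from this have "u \<oplus>\<^bsub>M\<^esub> v = (a \<oplus> b) \<odot>\<^bsub>M\<^esub> y \<oplus>\<^bsub>M\<^esub> (p \<oplus>\<^bsub>M\<^esub> q)"
      using assms(1) Wc by (simp add: smult_l_distr M.a_ac)
    ultimately show "u \<oplus>\<^bsub>M\<^esub> v \<in> ?H"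
      using W(3) by blast
  next
    fix a u assume a: "a \<in> carrier R" and "u \<in> ?H"
    then obtain b p where "b \<in> carrier R" "p \<in> ?W" "u = b \<odot>\<^bsub>M\<^esub> y \<oplus>\<^bsub>M\<^esub> p"
      by blast
    moreover from this a have "a \<odot>\<^bsub>M\<^esub> u = (a \<otimes> b) \<odot>\<^bsub>M\<^esub> y \<oplus>\<^bsub>M\<^esub> a \<odot>\<^bsub>M\<^esub> p"
      using assms(1) Wc by (simp add: smult_r_distr smult_assoc1)
    ultimately show "a \<odot>\<^bsub>M\<^esub> u \<in> ?H"
      using W(4) a by blast
  qed
  moreover have "insert y S \<subseteq> ?H"
  proof
    fix u assume "u \<in> insert y S"
    then consider "u = y" | "u \<in> S" by blast
    then show "u \<in> ?H"
    proof cases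
      case 1
      then have "u = \<one> \<odot>\<^bsub>M\<^esub> y \<oplus>\<^bsub>M\<^esub> \<zero>\<^bsub>M\<^esub>" using assms(1) by simp
      then show ?thesis using W(2) by blast
    next
      case 2
      then have "u = \<zero> \<odot>\<^bsub>M\<^esub> y \<oplus>\<^bsub>M\<^esub> u" "u \<in> ?W" using assms(1,2) span_superset[of S] by auto
      then show ?thesis by blast
    qed
  qed
  ultimately have "module_span R M (insert y S) \<subseteq> ?H"
    by (rule span_least)
  then show ?thesis
    using assms(3) that by blast
qed

text \<open>
  A generating set of least cardinality is irredundant.  The bound on the length is recorded because
  for such a basis no proper part of a transformed basis generates the module.
\<close>

lemma minimal_basis_exists:
  assumes "fin_gen R M H"
  obtains gs where "minimal_basis R M H gs"
    "\<And>S. finite S \<Longrightarrow> generates R M H S \<Longrightarrow> length gs \<le> card S"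
proof -
  let ?P = "\<lambda>S. finite S \<and> generates R M H S"
  obtain S where S: "?P S" "\<And>T. ?P T \<Longrightarrow> card S \<le> card T"
    using assms ex_has_least_nat[of ?P _ card] unfolding fin_gen_def by blast
  obtain gs where gs: "set gs = S" "distinct gs"
    using S(1) finite_distinct_list by blast
  have "\<not> generates R M H T" if "T \<subset> set gs" for T
    using that gs(1) S psubset_card_mono[of S T] finite_subset[of T S] by force
  then have "minimal_basis R M H gs"
    using gs S(1) by (auto simp: minimal_basis_def)
  then show ?thesis
    using that S(2) gs distinct_card by metis
qed

end

section \<open>Free modules\<close>

lemma free_module_simps:
  "x \<in> carrier (free_module R n) \<longleftrightarrow> x \<in> carrier_vec n \<and> (\<forall>i<n. x $ i \<in> carrier R)"
  "\<zero>\<^bsub>free_module R n\<^esub> = vec n (\<lambda>i. \<zero>\<^bsub>R\<^esub>)"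
  "x \<oplus>\<^bsub>free_module R n\<^esub> y = vec n (\<lambda>i. x $ i \<oplus>\<^bsub>R\<^esub> y $ i)"
  "a \<odot>\<^bsub>free_module R n\<^esub> x = vec n (\<lambda>i. a \<otimes>\<^bsub>R\<^esub> x $ i)"
  by (auto simp: free_module_def)

lemma left_module_free:
  assumes "ring R" shows "left_module R (free_module R n)"
proof -
  interpret ring R by fact
  have "abelian_group (free_module R n)"
  proof (rule abelian_groupI)
    fix x assume "x \<in> carrier (free_module R n)"
    then show "\<exists>y\<in>carrier (free_module R n). y \<oplus>\<^bsub>free_module R n\<^esub> x = \<zero>\<^bsub>free_module R n\<^esub>"
      by (intro bexI[of _ "vec n (\<lambda>i. \<ominus>\<^bsub>R\<^esub> x $ i)"]) (auto simp: free_module_simps l_neg)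
  qed (auto simp: free_module_simps a_ac intro!: eq_vecI)
  then show ?thesis
    using ring_axioms
    by (intro left_module.intro left_module_axioms.intro)
      (auto simp: free_module_simps m_assoc l_distr r_distr intro!: eq_vecI)
qed

context ring
begin

lemma lincomb_free_index:
  assumes "\<And>k. k < m \<Longrightarrow> r k \<in> carrier R" "\<And>k. k < m \<Longrightarrow> x k \<in> carrier (free_module R n)"
    and "j < n"
  shows "lincomb (free_module R n) m r x $ j = lincomb (regular_module R) m r (\<lambda>k. x k $ j)"
proof -
  interpret Free: left_module R "free_module R n"
    by (rule left_module_free) (rule ring_axioms)
  interpret Regular: left_module R "regular_module R"
    by (rule left_module_regular) (rule ring_axioms)
  show ?thesis
    using assms(1,2)
  proof (induction m)
    case (Suc m)
    have "lincomb (free_module R n) (Suc m) r x $ j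
        = r m \<otimes> x m $ j \<oplus> lincomb (free_module R n) m r x $ j"
      using Suc.prems assms(3) by (subst Free.lincomb_Suc) (auto simp: free_module_simps)
    then show ?case
      using Suc assms(3) Regular.lincomb_Suc[of m r "\<lambda>k. x k $ j"] by (simp add: free_module_simps)
  qed (use assms(3) in \<open>simp add: free_module_simps lincomb_def\<close>)
qed

end

section \<open>Submodules of free modules over a noetherian ring\<close>

context ring
begin

text \<open>
  By induction on the first coordinate \<open>k\<close> from which on all elements vanish.  The last coordinate that
  may be nonzero maps the submodule onto a left ideal; generators are lifts of generators of this
  ideal together with generators of the submodule on which this coordinate vanishes, too.
\<close>

lemma fin_gen_submodule_vanishing_from:
  assumes "left_noetherian R" "k \<le> n"
    and "submodule N R (free_module R n)"
    and "\<And>x j. x \<in> N \<Longrightarrow> k \<le> j \<Longrightarrow> j < n \<Longrightarrow> x $ j = \<zero>"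
  shows "fin_gen R (free_module R n) N"
  using assms(2-4)
proof (induction k arbitrary: N)
  case 0
  interpret F: left_module R "free_module R n"
    by (rule left_module_free) (rule ring_axioms)
  let ?F = "free_module R n"
  note N = F.submodule_facts[OF 0(2)]
  have zero: "N = {\<zero>\<^bsub>?F\<^esub>}"
    using N(1,2) 0(3) by (auto simp: free_module_simps intro!: eq_vecI)
  moreover have "module_span R ?F {} = N"
    using F.span_least[OF 0(2), of "{}"] F.submodule_zero[OF F.submodule_span, of "{}"] zero
    by auto
  ultimately show ?case
    unfolding fin_gen_def generates_def by auto
next
  case (Suc k)
  interpret F: left_module R "free_module R n"
    by (rule left_module_free) (rule ring_axioms)
  interpret Reg: left_module R "regular_module R"
    by (rule left_module_regular) (rule ring_axioms)
  let ?F = "free_module R n"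
  have k: "k < n" using Suc.prems(1) by simp
  have image: "submodule ((\<lambda>x. x $ k) ` H) R (regular_module R)" if "submodule H R ?F" for H
  proof (rule Reg.submoduleI)
    note H = F.submodule_facts[OF that]
    show "(\<lambda>x. x $ k) ` H \<subseteq> carrier (regular_module R)"
      using H(1) k by (auto simp: free_module_simps subset_iff)
    show "\<zero>\<^bsub>regular_module R\<^esub> \<in> (\<lambda>x. x $ k) ` H"
      using H(2) k by (auto simp: free_module_simps intro!: image_eqI[of _ _ "\<zero>\<^bsub>?F\<^esub>"])
    fix u assume "u \<in> (\<lambda>x. x $ k) ` H"
    then obtain x where x: "x \<in> H" "u = x $ k" by auto
    show "u \<oplus>\<^bsub>regular_module R\<^esub> v \<in> (\<lambda>x. x $ k) ` H" if v: "v \<in> (\<lambda>x. x $ k) ` H" for v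
    proof -
      from v obtain y where "y \<in> H" "v = y $ k" by auto
      then show ?thesis
        using H(3)[of x y] x k by (auto simp: free_module_simps intro!: image_eqI[of _ _ "x \<oplus>\<^bsub>?F\<^esub> y"])
    qed
    show "a \<odot>\<^bsub>regular_module R\<^esub> u \<in> (\<lambda>x. x $ k) ` H" if "a \<in> carrier R" for a
      using H(4)[of a x] x k that by (auto simp: free_module_simps intro!: image_eqI[of _ _ "a \<odot>\<^bsub>?F\<^esub> x"])
  qed
  note N = F.submodule_facts[OF Suc.prems(2)]
  obtain T where T: "finite T" "module_span R (regular_module R) T = (\<lambda>x. x $ k) ` N"
    using assms(1) image[OF Suc.prems(2)]
    unfolding left_noetherian_def fin_gen_def generates_def by blast
  have "T \<subseteq> (\<lambda>x. x $ k) ` N"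
    using T(2) Reg.span_superset by blast
  then obtain L where L: "L \<subseteq> N" "finite L" "T = (\<lambda>x. x $ k) ` L"
    using T(1) by (meson finite_subset_image)
  define N' where "N' = {x \<in> N. x $ k = \<zero>}"
  have "submodule N' R ?F"
    using N k by (intro F.submoduleI) (auto simp: N'_def free_module_simps)
  moreover have "x $ j = \<zero>" if "x \<in> N'" "k \<le> j" "j < n" for x j
    using that Suc.prems(3)[of x j] by (cases "j = k") (auto simp: N'_def)
  ultimately have "fin_gen R ?F N'"
    using Suc.IH[of N'] k by simp
  then obtain S where S: "finite S" "S \<subseteq> carrier ?F" "module_span R ?F S = N'"
    unfolding fin_gen_def generates_def by blast
  have LS: "L \<union> S \<subseteq> carrier ?F" "L \<union> S \<subseteq> N"
    using L(1) N(1) S F.span_superset[of S] by (auto simp: N'_def)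
  let ?W = "module_span R ?F (L \<union> S)"
  have subW: "submodule ?W R ?F"
    by (rule F.submodule_span[OF LS(1)])
  note W = F.submodule_facts[OF subW]
  have "N \<subseteq> ?W"
  proof
    fix x assume x: "x \<in> N"
    have "(\<lambda>x. x $ k) ` N \<subseteq> (\<lambda>x. x $ k) ` ?W"
      unfolding T(2)[symmetric] using image[OF subW] L(3) F.span_superset[of "L \<union> S"]
      by (intro Reg.span_least) auto
    then have "x $ k \<in> (\<lambda>x. x $ k) ` ?W"
      using x by blast
    then obtain y where y: "y \<in> ?W" "y $ k = x $ k"
      by force
    have yN: "y \<in> N"
      using F.span_least[OF Suc.prems(2) LS(2)] y(1) by blast
    have xc: "x \<in> carrier ?F" "y \<in> carrier ?F"
      using x yN N(1) by auto
    let ?z = "x \<oplus>\<^bsub>?F\<^esub> (\<ominus> \<one>) \<odot>\<^bsub>?F\<^esub> y"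
    have "?z \<in> N"
      using N(3)[OF x N(4)[OF _ yN]] by simp
    moreover have "?z $ k = \<zero>"
      using xc y(2) k by (auto simp: free_module_simps l_minus r_neg)
    ultimately have "?z \<in> ?W"
      using S(3) F.span_mono[OF LS(1), of S] by (auto simp: N'_def)
    then have "?z \<oplus>\<^bsub>?F\<^esub> y \<in> ?W"
      using W(3) y(1) by blast
    moreover have "?z \<oplus>\<^bsub>?F\<^esub> y = x"
      using xc by (auto simp: free_module_simps l_minus a_assoc l_neg intro!: eq_vecI)
    ultimately show "x \<in> ?W" by simp
  qed
  moreover have "?W \<subseteq> N"
    by (rule F.span_least[OF Suc.prems(2) LS(2)])
  ultimately show ?case
    unfolding fin_gen_def generates_def using LS(1) L(2) S(1) by (intro exI[of _ "L \<union> S"]) auto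
qed

lemma fin_gen_submodule_of_free:
  assumes "left_noetherian R" "submodule N R (free_module R n)"
  shows "fin_gen R (free_module R n) N"
  using fin_gen_submodule_vanishing_from[OF assms(1) order_refl assms(2)] by simp

end

section \<open>Relations and minimal resolutions\<close>

text \<open>
  The augmentation \<open>R\<^sup>v \<rightarrow> M\<close> that sends the free basis to \<open>gs\<close>; its kernel is the relationship
  submodule.
\<close>

definition presentation_map ::
  "('a, 'b, 'd) module_scheme \<Rightarrow> 'b list \<Rightarrow> 'a vec \<Rightarrow> 'b"
  where "presentation_map M gs x = lincomb M (length gs) (($) x) ((!) gs)"

lemma relationship_submodule_kernel:
  "relationship_submodule R M gs =
    {x \<in> carrier (free_module R (length gs)). presentation_map M gs x = \<zero>\<^bsub>M\<^esub>}"
  by (simp add: relationship_submodule_def presentation_map_def lincomb_def)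

context left_module
begin

lemma presentation_map_hom:
  assumes "set gs \<subseteq> carrier M"
  shows "presentation_map M gs \<in> module_hom R (free_module R (length gs)) M"
proof -
  have g: "gs ! k \<in> carrier M" if "k < length gs" for k
    using assms that by auto
  let ?v = "length gs"
  have add: "presentation_map M gs (x \<oplus>\<^bsub>free_module R ?v\<^esub> y)
      = presentation_map M gs x \<oplus>\<^bsub>M\<^esub> presentation_map M gs y"
    if "x \<in> carrier (free_module R ?v)" "y \<in> carrier (free_module R ?v)" for x y
  proof -
    have "presentation_map M gs (x \<oplus>\<^bsub>free_module R ?v\<^esub> y)
        = lincomb M ?v (\<lambda>k. x $ k \<oplus> y $ k) ((!) gs)"
      unfolding presentation_map_def using that g
      by (intro lincomb_cong) (auto simp: free_module_simps)
    then show ?thesis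
      unfolding presentation_map_def using that g by (simp add: lincomb_add free_module_simps)
  qed
  have smult: "presentation_map M gs (a \<odot>\<^bsub>free_module R ?v\<^esub> x) = a \<odot>\<^bsub>M\<^esub> presentation_map M gs x"
    if "a \<in> carrier R" "x \<in> carrier (free_module R ?v)" for a x
  proof -
    have "presentation_map M gs (a \<odot>\<^bsub>free_module R ?v\<^esub> x)
        = lincomb M ?v (\<lambda>k. a \<otimes> x $ k) ((!) gs)"
      unfolding presentation_map_def using that g
      by (intro lincomb_cong) (auto simp: free_module_simps)
    then show ?thesis
      unfolding presentation_map_def using that g by (simp add: lincomb_smult free_module_simps)
  qed
  have "presentation_map M gs x \<in> carrier M" if "x \<in> carrier (free_module R ?v)" for x
    unfolding presentation_map_def using that g by (intro lincomb_closed) (auto simp: free_module_simps)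
  then show ?thesis
    unfolding module_hom_def hom_def using add smult by auto
qed

lemma presentation_map_image:
  assumes "set gs \<subseteq> carrier M"
  shows "presentation_map M gs ` carrier (free_module R (length gs)) = module_span R M (set gs)"
proof -
  have g: "gs ! k \<in> carrier M" if "k < length gs" for k
    using assms that by auto
  have "lincomb M (length gs) r ((!) gs) \<in> presentation_map M gs ` carrier (free_module R (length gs))"
    if "\<And>k. k < length gs \<Longrightarrow> r k \<in> carrier R" for r
    using that g
    by (intro image_eqI[of _ _ "vec (length gs) r"])
      (auto simp: presentation_map_def free_module_simps intro!: lincomb_cong)
  moreover have "set gs = (!) gs ` {..<length gs}"
    by (auto simp: set_conv_nth)
  then have "module_span R M (set gs)
      = {lincomb M (length gs) r ((!) gs) | r. \<forall>k<length gs. r k \<in> carrier R}"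
    using span_family[of "length gs" "(!) gs"] g by simp
  ultimately show ?thesis
    by (auto simp: presentation_map_def free_module_simps)
qed

lemma presentation_map_basis:
  assumes "set gs \<subseteq> carrier M"
  shows "map (presentation_map M gs) (free_basis R (length gs)) = gs"
proof (rule nth_equalityI)
  fix j assume "j < length (map (presentation_map M gs) (free_basis R (length gs)))"
  then have j: "j < length gs" by (simp add: free_basis_def)
  have "lincomb M (length gs) (($) (vec (length gs) (\<lambda>i. if i = j then \<one> else \<zero>))) ((!) gs)
      = lincomb M (length gs) (\<lambda>i. if i = j then \<one> else \<zero>) ((!) gs)"
    using assms by (intro lincomb_cong) (auto simp: subset_iff)
  then show "map (presentation_map M gs) (free_basis R (length gs)) ! j = gs ! j"
    using j assms by (simp add: free_basis_def presentation_map_def lincomb_unit subset_iff)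
qed (simp add: free_basis_def)

lemma relationship_submodule_submodule:
  assumes "set gs \<subseteq> carrier M"
  shows "submodule (relationship_submodule R M gs) R (free_module R (length gs))"
proof -
  let ?F = "free_module R (length gs)"
  interpret F: left_module R ?F
    by (rule left_module_free) (rule R.ring_axioms)
  note h = presentation_map_hom[OF assms, unfolded module_hom_def hom_def]
  have "presentation_map M gs \<zero>\<^bsub>?F\<^esub> = \<zero>\<^bsub>M\<^esub>"
    unfolding presentation_map_def using assms
    by (intro lincomb_eq_zero) (auto simp: free_module_simps subset_iff)
  then show ?thesis
    unfolding relationship_submodule_kernel using h by (intro F.submoduleI) auto
qed

text \<open>
  Each kernel is a submodule of a finite free module, hence finitely generated, and so has a minimal
  basis that gives the next differential.
\<close>

lemma minimal_resolution_exists: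
  assumes "left_noetherian R" "minimal_basis R M (carrier M) gs"
  obtains n d where "minimal_resolution R M n (presentation_map M gs) d" "n 0 = length gs"
proof -
  note free = left_module_free[OF R.ring_axioms]
  \<comment> \<open>\<open>F i\<close> consists of the rank \<open>n i\<close> and the chosen minimal basis of the kernel inside \<open>R\<^bsup>n i\<^esup>\<close>.\<close>
  define nxt where "nxt = (\<lambda>N. SOME hs. minimal_basis R (free_module R (fst N)) (snd N) hs)"
  define F where "F = rec_nat (length gs, nxt (length gs, relationship_submodule R M gs))
    (\<lambda>_ (n, hs). (length hs, nxt (length hs, relationship_submodule R (free_module R n) hs)))"
  define n where "n = (\<lambda>i. fst (F i))"
  define hs where "hs = (\<lambda>i. snd (F i))"
  have nxt: "minimal_basis R (free_module R n) N (nxt (n, N))" if "submodule N R (free_module R n)" for n N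
  proof -
    have "fin_gen R (free_module R n) N"
      by (rule ring.fin_gen_submodule_of_free[OF R.ring_axioms assms(1) that])
    then obtain hs where "minimal_basis R (free_module R n) N hs"
      by (rule left_module.minimal_basis_exists[OF free])
    then show ?thesis
      unfolding nxt_def fst_conv snd_conv by (rule someI)
  qed
  have gs: "set gs \<subseteq> carrier M" "module_span R M (set gs) = carrier M"
    using assms(2) by (auto simp: minimal_basis_def generates_def)
  have F0: "F 0 = (length gs, nxt (length gs, relationship_submodule R M gs))"
    and FSuc: "\<And>i. F (Suc i) = (length (snd (F i)),
      nxt (length (snd (F i)), relationship_submodule R (free_module R (fst (F i))) (snd (F i))))"
    unfolding F_def by (simp_all only: nat.rec split_beta)
  have n0: "n 0 = length gs" and nSuc: "\<And>i. n (Suc i) = length (hs i)"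
    and hs0: "hs 0 = nxt (n 0, relationship_submodule R M gs)"
    and hsSuc: "\<And>i. hs (Suc i) = nxt (n (Suc i), relationship_submodule R (free_module R (n i)) (hs i))"
    unfolding n_def hs_def by (simp_all only: F0 FSuc fst_conv snd_conv)
  have basis0: "minimal_basis R (free_module R (n 0)) (relationship_submodule R M gs) (hs 0)"
    unfolding hs0 by (rule nxt) (simp add: n0 relationship_submodule_submodule[OF gs(1)])
  have basisSuc: "minimal_basis R (free_module R (n (Suc i)))
      (relationship_submodule R (free_module R (n i)) (hs i)) (hs (Suc i))"
    if "set (hs i) \<subseteq> carrier (free_module R (n i))" for i
    unfolding hsSuc
    by (rule nxt) (simp add: nSuc left_module.relationship_submodule_submodule[OF free that])
  have hs: "set (hs i) \<subseteq> carrier (free_module R (n i))" for i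
  proof (induction i)
    case 0
    then show ?case
      using basis0 by (auto simp: minimal_basis_def generates_def)
  next
    case (Suc i)
    then show ?case
      using basisSuc[of i] by (auto simp: minimal_basis_def generates_def)
  qed
  define d where "d = (\<lambda>i. presentation_map (free_module R (n i)) (hs i))"
  have d: "d i \<in> module_hom R (free_module R (n (Suc i))) (free_module R (n i))"
    "d i ` carrier (free_module R (n (Suc i))) = module_span R (free_module R (n i)) (set (hs i))"
    "map (d i) (free_basis R (n (Suc i))) = hs i" for i
    unfolding d_def nSuc
    by (rule left_module.presentation_map_hom[OF free hs] left_module.presentation_map_image[OF free hs]
      left_module.presentation_map_basis[OF free hs])+
  have img0: "module_span R (free_module R (n 0)) (set (hs 0)) = relationship_submodule R M gs"
    using basis0 by (simp add: minimal_basis_def generates_def)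
  have imgSuc: "module_span R (free_module R (n (Suc i))) (set (hs (Suc i)))
      = relationship_submodule R (free_module R (n i)) (hs i)" for i
    using basisSuc[OF hs] by (simp add: minimal_basis_def generates_def)
  have "minimal_basis R (free_module R (n i)) (module_span R (free_module R (n i)) (set (hs i))) (hs i)" for i
    using basis0 basisSuc[OF hs] img0 imgSuc by (cases i) simp_all
  moreover have "{x \<in> carrier (free_module R (n (Suc i))). d i x = \<zero>\<^bsub>free_module R (n i)\<^esub>}
      = module_span R (free_module R (n (Suc i))) (set (hs (Suc i)))" for i
    unfolding imgSuc by (simp add: relationship_submodule_kernel d_def nSuc)
  moreover have "{x \<in> carrier (free_module R (n 0)). presentation_map M gs x = \<zero>\<^bsub>M\<^esub>}
      = module_span R (free_module R (n 0)) (set (hs 0))"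
    unfolding img0 by (simp add: relationship_submodule_kernel n0)
  ultimately have "minimal_resolution R M n (presentation_map M gs) d"
    unfolding minimal_resolution_def One_nat_def d(2,3)
    using presentation_map_hom[OF gs(1)] presentation_map_image[OF gs(1)]
      presentation_map_basis[OF gs(1)] d(1) gs(2) assms(2) n0
    by simp
  then show ?thesis
    using that n0 by blast
qed

end

section \<open>Locality of the ring\<close>

text \<open>
  Equivalently, \<open>R\<close> is zero or has a single maximal left ideal, i.e. \<open>R\<close> is zero or local.
\<close>

definition left_local :: "('a, 'c) ring_scheme \<Rightarrow> bool"
  where "left_local R \<longleftrightarrow>
    (\<forall>a\<in>carrier R. \<forall>b\<in>carrier R. a \<oplus>\<^bsub>R\<^esub> b = \<one>\<^bsub>R\<^esub> \<longrightarrow>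
      (\<exists>c\<in>carrier R. c \<otimes>\<^bsub>R\<^esub> a = \<one>\<^bsub>R\<^esub>) \<or> (\<exists>c\<in>carrier R. c \<otimes>\<^bsub>R\<^esub> b = \<one>\<^bsub>R\<^esub>))"

text \<open>
  Uniqueness of minimal resolutions speaks about modules whose elements are sets of vectors.  The
  following copy of the left module \<open>R\<close> has elements of this type.
\<close>

definition singleton_vec :: "'a \<Rightarrow> 'a vec set"
  where "singleton_vec r = {vec 1 (\<lambda>_. r)}"

definition singleton_entry :: "'a vec set \<Rightarrow> 'a"
  where "singleton_entry X = the_elem X $ 0"

lemma singleton_entry_vec [simp]: "singleton_entry (singleton_vec r) = r"
  by (simp add: singleton_entry_def singleton_vec_def)

lemma singleton_vec_inject [simp]: "singleton_vec r = singleton_vec s \<longleftrightarrow> r = s"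
  by (metis singleton_entry_vec)

definition singleton_module :: "('a, 'c) ring_scheme \<Rightarrow> ('a, 'a vec set) module"
  where "singleton_module R =
    \<lparr>carrier = singleton_vec ` carrier R,
     monoid.mult = undefined, one = undefined,
     zero = singleton_vec \<zero>\<^bsub>R\<^esub>,
     add = (\<lambda>X Y. singleton_vec (singleton_entry X \<oplus>\<^bsub>R\<^esub> singleton_entry Y)),
     smult = (\<lambda>a X. singleton_vec (a \<otimes>\<^bsub>R\<^esub> singleton_entry X))\<rparr>"

lemma singleton_module_simps [simp]:
  "carrier (singleton_module R) = singleton_vec ` carrier R"
  "\<zero>\<^bsub>singleton_module R\<^esub> = singleton_vec \<zero>\<^bsub>R\<^esub>"
  "singleton_vec r \<oplus>\<^bsub>singleton_module R\<^esub> singleton_vec s = singleton_vec (r \<oplus>\<^bsub>R\<^esub> s)"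
  "a \<odot>\<^bsub>singleton_module R\<^esub> singleton_vec s = singleton_vec (a \<otimes>\<^bsub>R\<^esub> s)"
  by (simp_all add: singleton_module_def)

lemma left_module_singleton:
  assumes "ring R" shows "left_module R (singleton_module R)"
proof -
  interpret ring R by fact
  have "abelian_group (singleton_module R)"
  proof (rule abelian_groupI)
    fix x assume "x \<in> carrier (singleton_module R)"
    then obtain r where "r \<in> carrier R" "x = singleton_vec r"
      by auto
    then show "\<exists>y\<in>carrier (singleton_module R).
        y \<oplus>\<^bsub>singleton_module R\<^esub> x = \<zero>\<^bsub>singleton_module R\<^esub>"
      by (intro bexI[of _ "singleton_vec (\<ominus>\<^bsub>R\<^esub> r)"]) (auto simp: l_neg)
  qed (auto simp: a_ac)
  then show ?thesis
    using ring_axioms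
    by (intro left_module.intro left_module_axioms.intro) (auto simp: m_assoc l_distr r_distr)
qed

context ring
begin

lemma span_singleton_module:
  assumes "a \<in> carrier R"
  shows "module_span R (singleton_module R) {singleton_vec a} = (\<lambda>c. singleton_vec (c \<otimes> a)) ` carrier R"
proof -
  interpret N: left_module R "singleton_module R"
    by (rule left_module_singleton) (rule ring_axioms)
  have "lincomb (singleton_module R) (Suc 0) r (\<lambda>_. singleton_vec a) = singleton_vec (r 0 \<otimes> a)"
    if "r 0 \<in> carrier R" for r
    using that assms by (subst N.lincomb_Suc) auto
  moreover have "module_span R (singleton_module R) {singleton_vec a}
      = {lincomb (singleton_module R) (Suc 0) r (\<lambda>_. singleton_vec a) | r. \<forall>k<Suc 0. r k \<in> carrier R}"
    using N.span_family[of "Suc 0" "\<lambda>_. singleton_vec a"] assms by (simp add: lessThan_Suc)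
  ultimately have "module_span R (singleton_module R) {singleton_vec a}
      = {singleton_vec (r 0 \<otimes> a) | r :: nat \<Rightarrow> 'a. r 0 \<in> carrier R}"
    by auto
  then show ?thesis
    by (auto intro: exI[of _ "\<lambda>_. c" for c])
qed

text \<open>
  If \<open>a + b = 1\<close> and neither \<open>a\<close> nor \<open>b\<close> is left invertible, then \<open>(a, b)\<close> is a minimal basis of
  \<open>R\<close>, and so is \<open>(1)\<close>.  The augmentation of the second is bijective; an isomorphism of the
  resolutions that they start makes the augmentation of the first injective as well.
\<close>

lemma left_local_if_unique_minimal_resolutions:
  assumes "left_noetherian R" "unique_minimal_resolutions R"
  shows "left_local R"
  unfolding left_local_def
proof (intro ballI impI, rule ccontr)
  fix a b assume ab: "a \<in> carrier R" "b \<in> carrier R" "a \<oplus> b = \<one>"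
  assume contr: "\<not> ((\<exists>c\<in>carrier R. c \<otimes> a = \<one>) \<or> (\<exists>c\<in>carrier R. c \<otimes> b = \<one>))"
  let ?N = "singleton_module R"
  interpret N: left_module R ?N
    by (rule left_module_singleton) (rule ring_axioms)
  have nontriv: "\<one> \<noteq> \<zero>"
  proof
    assume "\<one> = \<zero>"
    then have "\<one> \<otimes> a = \<one>"
      using ab(1) by (simp add: one_zeroD)
    then show False
      using contr by blast
  qed
  have "a \<noteq> b"
  proof
    assume "a = b"
    then have "(\<one> \<oplus> \<one>) \<otimes> a = \<one>"
      using ab by (simp add: l_distr)
    then show False
      using contr by blast
  qed
  have full: "generates R ?N (carrier ?N) S"
    if S: "S \<subseteq> carrier ?N" "singleton_vec \<one> \<in> module_span R ?N S" for S
  proof -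
    note W = N.submodule_facts[OF N.submodule_span[OF S(1)]]
    have "singleton_vec r \<in> module_span R ?N S" if "r \<in> carrier R" for r
      using W(4)[OF that S(2)] that by simp
    then show ?thesis
      unfolding generates_def using S(1) W(1) by auto
  qed
  have basis1: "minimal_basis R ?N (carrier ?N) [singleton_vec \<one>]"
  proof -
    have "\<not> generates R ?N (carrier ?N) {}"
    proof
      have "submodule {\<zero>\<^bsub>?N\<^esub>} R ?N"
        by (rule N.submoduleI) auto
      then have "module_span R ?N {} \<subseteq> {\<zero>\<^bsub>?N\<^esub>}"
        by (rule N.span_least) auto
      moreover assume "generates R ?N (carrier ?N) {}"
      ultimately have "singleton_vec ` carrier R \<subseteq> {singleton_vec \<zero>}"
        by (simp add: generates_def)
      then have "singleton_vec \<one> \<in> {singleton_vec \<zero>}"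
        using one_closed by blast
      then show False
        using nontriv by simp
    qed
    moreover have "generates R ?N (carrier ?N) {singleton_vec \<one>}"
      using N.span_superset[of "{singleton_vec \<one>}"] by (intro full) auto
    moreover have "S = {}" if "S \<subset> {singleton_vec \<one>}" for S :: "'a vec set set"
      using that by blast
    ultimately show ?thesis
      unfolding minimal_basis_def by auto
  qed
  have basis2: "minimal_basis R ?N (carrier ?N) [singleton_vec a, singleton_vec b]"
  proof -
    let ?S = "{singleton_vec a, singleton_vec b}"
    have S: "?S \<subseteq> carrier ?N"
      using ab by auto
    have "singleton_vec a \<oplus>\<^bsub>?N\<^esub> singleton_vec b \<in> module_span R ?N ?S"
      using N.submodule_add[OF N.submodule_span[OF S]] N.span_superset[of ?S] by blast
    then have gen: "generates R ?N (carrier ?N) ?S"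
      using ab by (intro full S) simp
    have no_single: "\<not> generates R ?N (carrier ?N) S"
      if sc: "S \<subseteq> {singleton_vec c}" "c \<in> carrier R" "\<not> (\<exists>d\<in>carrier R. d \<otimes> c = \<one>)" for S c
    proof
      assume "generates R ?N (carrier ?N) S"
      then have "singleton_vec \<one> \<in> module_span R ?N {singleton_vec c}"
        using N.span_mono[of "{singleton_vec c}" S] sc(1,2) by (auto simp: generates_def)
      then obtain d where "d \<in> carrier R" "singleton_vec \<one> = singleton_vec (d \<otimes> c)"
        unfolding span_singleton_module[OF sc(2)] by blast
      then show False
        using sc(3) by auto
    qed
    have "\<not> generates R ?N (carrier ?N) S" if "S \<subset> ?S" for S
    proof -
      have "S \<subseteq> {singleton_vec a} \<or> S \<subseteq> {singleton_vec b}"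
        using that by blast
      then show ?thesis
        using no_single ab(1,2) contr by blast
    qed
    then show ?thesis
      using gen \<open>a \<noteq> b\<close> by (simp add: minimal_basis_def)
  qed
  obtain n d where res1: "minimal_resolution R ?N n (presentation_map ?N [singleton_vec \<one>]) d"
    and n: "n 0 = 1"
    using N.minimal_resolution_exists[OF assms(1) basis1] by auto
  obtain n' d' where
    res2: "minimal_resolution R ?N n' (presentation_map ?N [singleton_vec a, singleton_vec b]) d'"
    and n': "n' 0 = 2"
    by (rule N.minimal_resolution_exists[OF assms(1) basis2]) simp
  have "fin_gen R ?N (carrier ?N)"
    using basis1 unfolding fin_gen_def minimal_basis_def by blast
  then have "isomorphic_resolutions R n (presentation_map ?N [singleton_vec \<one>]) d
      n' (presentation_map ?N [singleton_vec a, singleton_vec b]) d'"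
    using assms(2) N.left_module_axioms res1 res2 unfolding unique_minimal_resolutions_def by blast
  then obtain f where f: "f \<in> module_iso R (free_module R 1) (free_module R 2)"
    and fe: "\<And>x. x \<in> carrier (free_module R 1) \<Longrightarrow>
      presentation_map ?N [singleton_vec a, singleton_vec b] (f x)
        = presentation_map ?N [singleton_vec \<one>] x"
    unfolding isomorphic_resolutions_def n[symmetric] n'[symmetric] by blast
  have e1: "presentation_map ?N [singleton_vec \<one>] x = singleton_vec (x $ 0)"
    if "x \<in> carrier (free_module R 1)" for x
    using that by (simp add: presentation_map_def free_module_simps N.lincomb_1)
  have e2: "presentation_map ?N [singleton_vec a, singleton_vec b] y
      = singleton_vec (y $ 1 \<otimes> b \<oplus> y $ 0 \<otimes> a)"
    if "y \<in> carrier (free_module R 2)" for y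
    using that ab by (simp add: presentation_map_def free_module_simps N.lincomb_2)
  have commute: "a \<otimes> b = b \<otimes> a"
  proof -
    have "a \<otimes> (a \<oplus> b) = (a \<oplus> b) \<otimes> a"
      using ab by simp
    then have "a \<otimes> a \<oplus> a \<otimes> b = a \<otimes> a \<oplus> b \<otimes> a"
      using ab(1,2) by (simp only: l_distr r_distr)
    then show ?thesis
      using ab(1,2) by simp
  qed
  \<comment> \<open>\<open>?y\<close> is the relation \<open>b a - a b = 0\<close> of the basis \<open>(a, b)\<close>, \<open>?z\<close> the trivial relation.\<close>
  let ?y = "vec 2 (\<lambda>i. if i = 0 then b else \<ominus> a)"
  let ?z = "vec 2 (\<lambda>i. \<zero>)"
  have yz: "?y \<in> carrier (free_module R 2)" "?z \<in> carrier (free_module R 2)"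
    using ab by (auto simp: free_module_simps)
  then obtain p q where p: "p \<in> carrier (free_module R 1)" "?y = f p"
    and q: "q \<in> carrier (free_module R 1)" "?z = f q"
    using f unfolding module_iso_def bij_betw_def by blast
  have "singleton_vec (p $ 0) = singleton_vec \<zero>"
    using fe[OF p(1), folded p(2)] e1[OF p(1)] e2[OF yz(1)] ab commute by (simp add: l_minus l_neg)
  moreover have "singleton_vec (q $ 0) = singleton_vec \<zero>"
    using fe[OF q(1), folded q(2)] e1[OF q(1)] e2[OF yz(2)] ab by simp
  ultimately have "p = q"
    using p(1) q(1) by (auto simp: free_module_simps intro!: eq_vecI)
  then have "?y = ?z"
    using p(2) q(2) by simp
  then have "?y $ 0 = ?z $ 0" "?y $ 1 = ?z $ 1"
    by simp_all
  then have "b = \<zero>" "\<ominus> a = \<zero>"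
    by simp_all
  then show False
    using ab nontriv by (metis minus_minus minus_zero r_zero)
qed

lemma left_localE:
  assumes "left_local R" "a \<oplus> b = \<one>" "a \<in> carrier R" "b \<in> carrier R"
  obtains c where "c \<in> carrier R" "c \<otimes> a = \<one>" | c where "c \<in> carrier R" "c \<otimes> b = \<one>"
proof -
  have "(\<exists>c\<in>carrier R. c \<otimes> a = \<one>) \<or> (\<exists>c\<in>carrier R. c \<otimes> b = \<one>)"
    using assms(1)[unfolded left_local_def] assms(2-4) by simp
  then show ?thesis
    using that by (elim disjE bexE)
qed

text \<open>
  The element \<open>y x\<close> is idempotent, and in a local ring one of the complementary idempotents \<open>y x\<close> and
  \<open>1 - y x\<close> is left invertible, hence equal to \<open>1\<close>.  In the second case
  \<open>y x = 0\<close>, so \<open>1 = x (y x) y = 0\<close> and the ring is zero.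
\<close>

lemma left_local_left_inverse_Units:
  assumes "left_local R" "x \<in> carrier R" "y \<in> carrier R" "x \<otimes> y = \<one>"
  shows "y \<in> Units R"
proof -
  let ?e = "y \<otimes> x" and ?f = "\<one> \<ominus> y \<otimes> x"
  have ee: "?e \<otimes> ?e = ?e"
    using assms by (metis m_assoc m_closed r_one)
  have "?e \<oplus> ?f = \<one>"
    using assms(2,3) by (simp add: minus_eq a_lcomm r_neg)
  then consider c where "c \<in> carrier R" "c \<otimes> ?e = \<one>" | c where "c \<in> carrier R" "c \<otimes> ?f = \<one>"
    by (rule left_localE[OF assms(1)]) (use assms(2,3) in auto)
  then have "?e = \<one>"
  proof cases
    case 1
    have "?e = (c \<otimes> ?e) \<otimes> ?e"
      using 1 assms by simp
    also have "\<dots> = c \<otimes> (?e \<otimes> ?e)"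
      using 1(1) assms by (simp only: m_assoc m_closed)
    finally show ?thesis
      using ee 1(2) by simp
  next
    case 2
    have "?f \<otimes> ?e = \<zero>"
      using assms(2,3) ee by (simp add: minus_eq l_distr l_minus r_neg)
    moreover have "?e = (c \<otimes> ?f) \<otimes> ?e"
      using 2 assms by simp
    then have "?e = c \<otimes> (?f \<otimes> ?e)"
      using 2(1) assms by (simp only: m_assoc m_closed minus_closed one_closed)
    ultimately have "?e = \<zero>"
      using 2(1) by simp
    moreover have "\<one> = x \<otimes> ?e \<otimes> y"
      using assms by (metis m_assoc m_closed r_one)
    ultimately have "\<one> = \<zero>"
      using assms(2,3) by simp
    then show ?thesis
      using \<open>?e = \<zero>\<close> by simp
  qed
  then show ?thesis
    using assms by (auto simp: Units_def)
qed

text \<open>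
  The defining property of \<open>left_local\<close> extends from two summands to finitely many.
\<close>

lemma left_local_unit_summand:
  assumes "left_local R" "\<one> \<noteq> \<zero>"
    and "\<And>k. k < n \<Longrightarrow> f k \<in> carrier R" "c \<in> carrier R"
    and "c \<otimes> lincomb (regular_module R) n f (\<lambda>_. \<one>) = \<one>"
  shows "\<exists>k<n. \<exists>d\<in>carrier R. d \<otimes> f k = \<one>"
  using assms(3-5)
proof (induction n arbitrary: c)
  case 0
  interpret Reg: left_module R "regular_module R"
    by (rule left_module_regular) (rule ring_axioms)
  show ?case
    using 0 assms(2) by simp
next
  case (Suc n)
  interpret Reg: left_module R "regular_module R"
    by (rule left_module_regular) (rule ring_axioms)
  let ?s = "lincomb (regular_module R) n f (\<lambda>_. \<one>)"
  have s: "?s \<in> carrier R" "f n \<in> carrier R"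
    using Reg.lincomb_closed[of n f "\<lambda>_. \<one>"] Suc.prems(1) by auto
  have "lincomb (regular_module R) (Suc n) f (\<lambda>_. \<one>) = f n \<oplus> ?s"
    using Reg.lincomb_Suc[of n f "\<lambda>_. \<one>"] Suc.prems(1) by simp
  then have "c \<otimes> f n \<oplus> c \<otimes> ?s = \<one>"
    using Suc.prems(2,3) s by (simp add: r_distr)
  then consider d where "d \<in> carrier R" "d \<otimes> (c \<otimes> f n) = \<one>"
    | d where "d \<in> carrier R" "d \<otimes> (c \<otimes> ?s) = \<one>"
    by (rule left_localE[OF assms(1)]) (use s Suc.prems(2) in auto)
  then show ?case
  proof cases
    case 1
    then have "(d \<otimes> c) \<otimes> f n = \<one>"
      using s Suc.prems(2) by (simp add: m_assoc)
    then show ?thesis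
      using 1(1) Suc.prems(2) by blast
  next
    case 2
    then have "(d \<otimes> c) \<otimes> ?s = \<one>"
      using s Suc.prems(2) by (simp add: m_assoc)
    then show ?thesis
      using Suc.IH[of "d \<otimes> c"] 2(1) Suc.prems(1,2) less_Suc_eq by auto
  qed
qed

text \<open>
  In a local ring the nonunits form a two-sided ideal, and \<open>1 - s\<close> is invertible for \<open>s\<close> in this ideal.  The lemma puts
  this in the form that the exchange step uses: a sum of products \<open>b k * c k\<close> with value \<open>s\<close> such that \<open>1 - s\<close> is
  not left invertible has a summand with \<open>b k\<close> a unit and \<open>c k\<close> nonzero.
\<close>

lemma left_local_products:
  assumes "left_local R"
    and "\<And>k. k < n \<Longrightarrow> b k \<in> carrier R" "\<And>k. k < n \<Longrightarrow> c k \<in> carrier R"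
  shows "(\<exists>u\<in>carrier R. u \<otimes> (\<one> \<ominus> lincomb (regular_module R) n b c) = \<one>) \<or>
    (\<exists>k<n. b k \<in> Units R \<and> c k \<noteq> \<zero>)"
proof (cases "\<one> = \<zero>")
  case True
  interpret Reg: left_module R "regular_module R"
    by (rule left_module_regular) (rule ring_axioms)
  have "\<one> \<ominus> lincomb (regular_module R) n b c \<in> carrier R"
    using Reg.lincomb_closed[of n b c] assms(2,3) by simp
  then show ?thesis
    using True one_zeroD by auto
next
  case False
  interpret Reg: left_module R "regular_module R"
    by (rule left_module_regular) (rule ring_axioms)
  let ?s = "lincomb (regular_module R) n b c"
  have s: "?s \<in> carrier R"
    using Reg.lincomb_closed[of n b c] assms(2,3) by simp
  then have "?s \<oplus> (\<one> \<ominus> ?s) = \<one>"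
    by (simp add: minus_eq a_lcomm r_neg)
  then consider "\<exists>u\<in>carrier R. u \<otimes> (\<one> \<ominus> ?s) = \<one>" | u where "u \<in> carrier R" "u \<otimes> ?s = \<one>"
    by (rule left_localE[OF assms(1)]) (use s in auto)
  then show ?thesis
  proof cases
    case 2
    have "?s = lincomb (regular_module R) n (\<lambda>k. b k \<otimes> c k) (\<lambda>_. \<one>)"
      unfolding lincomb_def using assms(2,3) by (intro Reg.M.finsum_cong') auto
    then obtain k d where k: "k < n" "d \<in> carrier R" "d \<otimes> (b k \<otimes> c k) = \<one>"
      using left_local_unit_summand[OF assms(1) False, of n "\<lambda>k. b k \<otimes> c k" u] 2 assms(2,3) by auto
    then have inv: "(d \<otimes> b k) \<otimes> c k = \<one>"
      using assms(2,3) by (simp add: m_assoc)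
    then have "c k \<noteq> \<zero>"
      using k False assms(2) by auto
    have "c k \<in> Units R"
      using left_local_left_inverse_Units[OF assms(1) _ _ inv] k assms(2,3) by simp
    then have "c k \<otimes> (d \<otimes> b k) = \<one>"
      using inv k assms(2,3) by (metis Units_inv_closed Units_l_inv Units_r_inv m_assoc m_closed r_one l_one)
    then have "(c k \<otimes> d) \<otimes> b k = \<one>"
      using k assms(2,3) by (simp add: m_assoc)
    then have "b k \<in> Units R"
      using left_local_left_inverse_Units[OF assms(1), of "c k \<otimes> d"] k assms(2,3) by simp
    then show ?thesis
      using k \<open>c k \<noteq> \<zero>\<close> by blast
  qed simp
qed

end

section \<open>Matrices acting on families\<close>

definition mat_act :: "('a, 'b, 'd) module_scheme \<Rightarrow> 'a mat \<Rightarrow> (nat \<Rightarrow> 'b) \<Rightarrow> nat \<Rightarrow> 'b"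
  where "mat_act M A x i = lincomb M (dim_col A) (\<lambda>k. A $$ (i, k)) x"

context ring
begin

lemma lincomb_regular:
  assumes "\<And>k. k < n \<Longrightarrow> r k \<in> carrier R" "\<And>k. k < n \<Longrightarrow> x k \<in> carrier R"
  shows "lincomb (regular_module R) n r x = (\<Oplus>k\<in>{..<n}. r k \<otimes> x k)"
proof -
  interpret Reg: left_module R "regular_module R"
    by (rule left_module_regular) (rule ring_axioms)
  show ?thesis
    using assms
  proof (induction n)
    case (Suc n)
    have "(\<Oplus>k\<in>insert n {..<n}. r k \<otimes> x k) = r n \<otimes> x n \<oplus> (\<Oplus>k\<in>{..<n}. r k \<otimes> x k)"
      using Suc.prems by (intro finsum_insert) auto
    then show ?case
      using Suc Reg.lincomb_Suc[of n r x] by (simp add: lessThan_Suc)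
  qed simp
qed

lemma matricesD:
  assumes "A \<in> matrices R u v"
  shows "dim_row A = u" "dim_col A = v" "\<And>i j. i < u \<Longrightarrow> j < v \<Longrightarrow> A $$ (i, j) \<in> carrier R"
  using assms by (auto simp: matrices_def)

lemma matricesI:
  assumes "dim_row A = u" "dim_col A = v" "\<And>i j. i < u \<Longrightarrow> j < v \<Longrightarrow> A $$ (i, j) \<in> carrier R"
  shows "A \<in> matrices R u v"
  unfolding matrices_def using assms by (intro CollectI conjI carrier_matI allI impI)

lemma matrix_mult_dim [simp]:
  "dim_row (matrix_mult R A B) = dim_row A" "dim_col (matrix_mult R A B) = dim_col B"
  by (simp_all add: matrix_mult_def)

lemma matrix_mult_index:
  assumes "A \<in> matrices R u v" "B \<in> matrices R v w" "i < u" "k < w"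
  shows "matrix_mult R A B $$ (i, k) = mat_act (regular_module R) A (\<lambda>j. B $$ (j, k)) i"
  using matricesD[OF assms(1)] matricesD[OF assms(2)] assms(3,4)
  by (simp add: matrix_mult_def mat_act_def lincomb_regular)

lemma matrix_mult_closed:
  assumes "A \<in> matrices R u v" "B \<in> matrices R v w"
  shows "matrix_mult R A B \<in> matrices R u w"
proof -
  interpret Reg: left_module R "regular_module R"
    by (rule left_module_regular) (rule ring_axioms)
  note A = matricesD[OF assms(1)] and B = matricesD[OF assms(2)]
  have "matrix_mult R A B $$ (i, k) \<in> carrier R" if "i < u" "k < w" for i k
  proof -
    have "mat_act (regular_module R) A (\<lambda>j. B $$ (j, k)) i \<in> carrier (regular_module R)"
      unfolding mat_act_def A(2) using A(3) B(3) that by (intro Reg.lincomb_closed) simp_all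
    then show ?thesis
      using matrix_mult_index[OF assms that] by simp
  qed
  then show ?thesis
    by (intro matricesI) (simp_all only: matrix_mult_dim A(1) B(2))
qed

lemma identity_matrix_closed: "identity_matrix R n \<in> matrices R n n"
  by (rule matricesI) (simp_all add: identity_matrix_def)

end

context left_module
begin

lemma mat_act_closed:
  assumes "A \<in> matrices R u v" "\<And>k. k < v \<Longrightarrow> x k \<in> carrier M" "i < u"
  shows "mat_act M A x i \<in> carrier M"
  using R.matricesD[OF assms(1)] assms(2,3) by (simp add: mat_act_def)

lemma mat_act_cong:
  assumes "A \<in> matrices R u v" "\<And>k. k < v \<Longrightarrow> y k \<in> carrier M"
    and "\<And>k. k < v \<Longrightarrow> x k = y k" "i < u"
  shows "mat_act M A x i = mat_act M A y i"
  using R.matricesD[OF assms(1)] assms(2-4) unfolding mat_act_def by (intro lincomb_cong) auto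

lemma mat_act_identity:
  assumes "\<And>k. k < n \<Longrightarrow> x k \<in> carrier M" "i < n"
  shows "mat_act M (identity_matrix R n) x i = x i"
proof -
  have "mat_act M (identity_matrix R n) x i = lincomb M n (\<lambda>k. if k = i then \<one> else \<zero>) x"
    unfolding mat_act_def using assms by (auto simp: identity_matrix_def intro!: lincomb_cong)
  then show ?thesis
    using lincomb_unit[OF assms(2)] assms(1) by simp
qed

lemma lincomb_mat_act:
  assumes "A \<in> matrices R u v" "\<And>k. k < v \<Longrightarrow> x k \<in> carrier M" "\<And>i. i < u \<Longrightarrow> s i \<in> carrier R"
  shows "lincomb M u s (mat_act M A x)
    = lincomb M v (\<lambda>k. lincomb (regular_module R) u s (\<lambda>i. A $$ (i, k))) x"
  using R.matricesD[OF assms(1)] assms(2,3)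
    lincomb_lincomb[of u s v "\<lambda>i k. A $$ (i, k)" x] by (simp add: mat_act_def[abs_def])

lemma mat_act_mult:
  assumes "A \<in> matrices R u v" "B \<in> matrices R v w" "\<And>k. k < w \<Longrightarrow> x k \<in> carrier M" "i < u"
  shows "mat_act M (matrix_mult R A B) x i = mat_act M A (mat_act M B x) i"
proof -
  note A = R.matricesD[OF assms(1)] and B = R.matricesD[OF assms(2)]
  have "mat_act M A (mat_act M B x) i
      = lincomb M w (\<lambda>k. mat_act (regular_module R) A (\<lambda>j. B $$ (j, k)) i) x"
    unfolding mat_act_def[of _ A] A(2)
    using assms(3,4) A(3) by (intro lincomb_mat_act[OF assms(2)]) simp_all
  also have "\<dots> = mat_act M (matrix_mult R A B) x i"
    unfolding mat_act_def[of M "matrix_mult R A B"] matrix_mult_dim B(2)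
    using assms(3) R.matrix_mult_index[OF assms(1,2,4)]
      R.matricesD(3)[OF R.matrix_mult_closed[OF assms(1,2)] assms(4)]
    by (intro lincomb_cong) auto
  finally show ?thesis by simp
qed

end

context ring
begin

lemma matrix_mult_assoc:
  assumes "A \<in> matrices R u v" "B \<in> matrices R v w" "C \<in> matrices R w z"
  shows "matrix_mult R (matrix_mult R A B) C = matrix_mult R A (matrix_mult R B C)"
proof (rule eq_matI)
  interpret Reg: left_module R "regular_module R"
    by (rule left_module_regular) (rule ring_axioms)
  note A = matricesD[OF assms(1)] and B = matricesD[OF assms(2)] and C = matricesD[OF assms(3)]
  note AB = matrix_mult_closed[OF assms(1,2)] and BC = matrix_mult_closed[OF assms(2,3)]
  fix i k assume "i < dim_row (matrix_mult R A (matrix_mult R B C))"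
    "k < dim_col (matrix_mult R A (matrix_mult R B C))"
  then have i: "i < u" and k: "k < z"
    using A C by simp_all
  let ?c = "\<lambda>l. C $$ (l, k)"
  have c: "?c l \<in> carrier (regular_module R)" if "l < w" for l
    using C k that by simp
  have "matrix_mult R A (matrix_mult R B C) $$ (i, k)
      = mat_act (regular_module R) A (\<lambda>j. matrix_mult R B C $$ (j, k)) i"
    by (rule matrix_mult_index[OF assms(1) BC i k])
  also have "\<dots> = mat_act (regular_module R) A (mat_act (regular_module R) B ?c) i"
    using matrix_mult_index[OF assms(2,3) _ k] Reg.mat_act_closed[OF assms(2) c]
    by (intro Reg.mat_act_cong[OF assms(1)] i) auto
  also have "\<dots> = mat_act (regular_module R) (matrix_mult R A B) ?c i"
    using Reg.mat_act_mult[OF assms(1,2) c i] by simp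
  also have "\<dots> = matrix_mult R (matrix_mult R A B) C $$ (i, k)"
    by (rule matrix_mult_index[OF AB assms(3) i k, symmetric])
  finally show "matrix_mult R (matrix_mult R A B) C $$ (i, k)
      = matrix_mult R A (matrix_mult R B C) $$ (i, k)"
    by simp
qed simp_all

lemma matrix_mult_identity_left:
  assumes "A \<in> matrices R u v"
  shows "matrix_mult R (identity_matrix R u) A = A"
proof (rule eq_matI)
  interpret Reg: left_module R "regular_module R"
    by (rule left_module_regular) (rule ring_axioms)
  note A = matricesD[OF assms]
  fix i j assume "i < dim_row A" "j < dim_col A"
  then show "matrix_mult R (identity_matrix R u) A $$ (i, j) = A $$ (i, j)"
    using A matrix_mult_index[OF identity_matrix_closed assms]
      Reg.mat_act_identity[of u "\<lambda>k. A $$ (k, j)"] by simp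
qed (use matricesD[OF assms] matricesD[OF identity_matrix_closed[of u]] in simp_all)

lemma invertible_matricesE:
  assumes "P \<in> invertible_matrices R n"
  obtains P' where "P \<in> matrices R n n" "P' \<in> invertible_matrices R n" "P' \<in> matrices R n n"
    "matrix_mult R P P' = identity_matrix R n" "matrix_mult R P' P = identity_matrix R n"
  using assms unfolding invertible_matrices_def by blast

lemma identity_matrix_invertible: "identity_matrix R n \<in> invertible_matrices R n"
  unfolding invertible_matrices_def
  using identity_matrix_closed[of n] matrix_mult_identity_left[OF identity_matrix_closed] by blast

lemma matrix_mult_invertible:
  assumes "P \<in> invertible_matrices R n" "Q \<in> invertible_matrices R n"
  shows "matrix_mult R P Q \<in> invertible_matrices R n"
proof -
  have inverse: "matrix_mult R (matrix_mult R A B) (matrix_mult R B' A') = identity_matrix R n"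
    if "A \<in> matrices R n n" "A' \<in> matrices R n n" "B \<in> matrices R n n" "B' \<in> matrices R n n"
      and "matrix_mult R A A' = identity_matrix R n" "matrix_mult R B B' = identity_matrix R n"
    for A A' B B'
  proof -
    have "matrix_mult R B (matrix_mult R B' A') = A'"
      using matrix_mult_assoc[OF that(3,4,2)] matrix_mult_identity_left[OF that(2)] that(6) by simp
    then show ?thesis
      using matrix_mult_assoc[OF that(1,3) matrix_mult_closed[OF that(4,2)]] that(5) by simp
  qed
  obtain P' where P: "P \<in> matrices R n n" "P' \<in> matrices R n n"
    "matrix_mult R P P' = identity_matrix R n" "matrix_mult R P' P = identity_matrix R n"
    by (rule invertible_matricesE[OF assms(1)])
  obtain Q' where Q: "Q \<in> matrices R n n" "Q' \<in> matrices R n n"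
    "matrix_mult R Q Q' = identity_matrix R n" "matrix_mult R Q' Q = identity_matrix R n"
    by (rule invertible_matricesE[OF assms(2)])
  show ?thesis
    unfolding invertible_matrices_def
    using matrix_mult_closed[OF P(1) Q(1)] matrix_mult_closed[OF Q(2) P(2)]
      inverse[OF P(1,2) Q(1,2) P(3) Q(3)] inverse[OF Q(2,1) P(2,1) Q(4) P(4)]
    by blast
qed

text \<open>
  The identity matrix with row \<open>i\<close> replaced by \<open>c\<close>; invertible as soon as \<open>c i\<close> is a unit.
\<close>

definition elementary_matrix :: "nat \<Rightarrow> nat \<Rightarrow> (nat \<Rightarrow> 'a) \<Rightarrow> 'a mat"
  where "elementary_matrix n i c =
    mat n n (\<lambda>(p, k). if p = i then c k else if k = p then \<one> else \<zero>)"

lemma elementary_matrix_closed: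
  assumes "\<And>k. k < n \<Longrightarrow> c k \<in> carrier R"
  shows "elementary_matrix n i c \<in> matrices R n n"
  using assms by (intro matricesI) (simp_all add: elementary_matrix_def)

end

context left_module
begin

lemma mat_act_elementary:
  assumes "\<And>k. k < n \<Longrightarrow> c k \<in> carrier R" "\<And>k. k < n \<Longrightarrow> x k \<in> carrier M" "p < n"
  shows "mat_act M (elementary_matrix n i c) x p = (if p = i then lincomb M n c x else x p)"
proof -
  have "mat_act M (elementary_matrix n i c) x p
      = lincomb M n (if p = i then c else (\<lambda>k. if k = p then \<one> else \<zero>)) x"
    unfolding mat_act_def using assms
    by (auto simp: elementary_matrix_def intro!: lincomb_cong split: if_splits)
  then show ?thesis
    using assms lincomb_unit[OF assms(3), of x] by simp
qed

end

context ring
begin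

lemma elementary_matrix_inverse:
  assumes "\<And>k. k < n \<Longrightarrow> c k \<in> carrier R" "i < n" "c i \<in> Units R"
  shows "matrix_mult R (elementary_matrix n i c)
      (elementary_matrix n i (\<lambda>k. if k = i then inv (c i) else \<ominus> (inv (c i) \<otimes> c k)))
    = identity_matrix R n" (is "matrix_mult R ?E ?E' = _")
proof (rule eq_matI)
  interpret Reg: left_module R "regular_module R"
    by (rule left_module_regular) (rule ring_axioms)
  let ?c' = "\<lambda>k. if k = i then inv (c i) else \<ominus> (inv (c i) \<otimes> c k)"
  have c': "?c' k \<in> carrier R" if "k < n" for k
    using assms that by auto
  note E = elementary_matrix_closed[of n c i, OF assms(1)]
    and E' = elementary_matrix_closed[of n ?c' i, OF c']
  show dims: "dim_row (matrix_mult R ?E ?E') = dim_row (identity_matrix R n)"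
    "dim_col (matrix_mult R ?E ?E') = dim_col (identity_matrix R n)"
    by (simp_all add: elementary_matrix_def identity_matrix_def)
  fix p j assume "p < dim_row (identity_matrix R n)" "j < dim_col (identity_matrix R n)"
  then have pj: "p < n" "j < n"
    by (simp_all add: identity_matrix_def)
  let ?x = "\<lambda>k. ?E' $$ (k, j)"
  have x: "?x k \<in> carrier (regular_module R)" if "k < n" for k
    using matricesD(3)[OF E' that pj(2)] by simp
  have "matrix_mult R ?E ?E' $$ (p, j)
      = (if p = i then lincomb (regular_module R) n c ?x else ?x p)"
    using matrix_mult_index[OF E E' pj] Reg.mat_act_elementary[OF assms(1) x pj(1), where i = i] by simp
  moreover have "lincomb (regular_module R) n c ?x = (if j = i then \<one> else \<zero>)"
  proof -
    let ?d = "\<lambda>k. if k = i then \<zero> else c k"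
    have split: "lincomb (regular_module R) n c ?x
        = c i \<otimes> ?x i \<oplus> lincomb (regular_module R) n ?d ?x"
      using Reg.lincomb_split_at[OF assms(2,1) x] by simp
    have "lincomb (regular_module R) n ?d ?x
        = lincomb (regular_module R) n (\<lambda>k. if k = j then ?d j else \<zero>) (\<lambda>_. \<one>)"
      unfolding lincomb_def using assms pj
      by (intro Reg.M.finsum_cong') (auto simp: elementary_matrix_def)
    also have "\<dots> = ?d j"
      using Reg.lincomb_single[OF pj(2), of "?d j" "\<lambda>_. \<one>"] assms pj by simp
    finally have "lincomb (regular_module R) n c ?x = c i \<otimes> ?c' j \<oplus> ?d j"
      using split pj assms(2) by (simp add: elementary_matrix_def)
    also have "\<dots> = (if j = i then \<one> else \<zero>)"
    proof (cases "j = i")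
      case False
      have "c i \<otimes> \<ominus> (inv (c i) \<otimes> c j) = \<ominus> (c i \<otimes> inv (c i) \<otimes> c j)"
        using assms pj by (simp add: r_minus m_assoc[symmetric] Units_closed)
      then show ?thesis
        using assms pj False by (simp add: l_neg)
    qed (use assms in simp)
    finally show ?thesis .
  qed
  ultimately show "matrix_mult R ?E ?E' $$ (p, j) = identity_matrix R n $$ (p, j)"
    using pj by (auto simp: identity_matrix_def elementary_matrix_def)
qed

lemma elementary_matrix_invertible:
  assumes "\<And>k. k < n \<Longrightarrow> c k \<in> carrier R" "i < n" "c i \<in> Units R"
  shows "elementary_matrix n i c \<in> invertible_matrices R n"
proof -
  let ?c' = "\<lambda>k. if k = i then inv (c i) else \<ominus> (inv (c i) \<otimes> c k)"
  have c': "?c' k \<in> carrier R" if "k < n" for k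
    using assms that by auto
  have "elementary_matrix n i (\<lambda>k. if k = i then inv (?c' i) else \<ominus> (inv (?c' i) \<otimes> ?c' k))
      = elementary_matrix n i c"
  proof -
    have "\<ominus> (c i \<otimes> \<ominus> (inv (c i) \<otimes> c k)) = c k" if "k < n" for k
    proof -
      have "\<ominus> (c i \<otimes> \<ominus> (inv (c i) \<otimes> c k)) = c i \<otimes> inv (c i) \<otimes> c k"
        using assms that by (simp add: r_minus m_assoc[symmetric] Units_closed)
      then show ?thesis
        using assms that by simp
    qed
    then show ?thesis
      unfolding elementary_matrix_def using assms(3) by (intro cong_mat) auto
  qed
  then have "matrix_mult R (elementary_matrix n i ?c') (elementary_matrix n i c)
      = identity_matrix R n"
    using elementary_matrix_inverse[of n ?c' i] c' assms(2,3) by simp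
  moreover have "matrix_mult R (elementary_matrix n i c) (elementary_matrix n i ?c')
      = identity_matrix R n"
    using assms by (rule elementary_matrix_inverse)
  ultimately show ?thesis
    unfolding invertible_matrices_def
    using elementary_matrix_closed[of n c i] elementary_matrix_closed[of n ?c' i] assms(1) c' by blast
qed

end

section \<open>Exchange over local rings\<close>

definition row_equivalent ::
  "('a, 'c) ring_scheme \<Rightarrow> ('a, 'b, 'd) module_scheme \<Rightarrow> nat \<Rightarrow> (nat \<Rightarrow> 'b) \<Rightarrow> (nat \<Rightarrow> 'b) \<Rightarrow> bool"
  where "row_equivalent R M m x z \<longleftrightarrow>
    (\<exists>P\<in>invertible_matrices R m. \<forall>i<m. z i = mat_act M P x i)"

context left_module
begin

lemma row_equivalent_refl:
  assumes "\<And>k. k < m \<Longrightarrow> x k \<in> carrier M"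
  shows "row_equivalent R M m x x"
  unfolding row_equivalent_def
  by (intro bexI[of _ "identity_matrix R m"] R.identity_matrix_invertible)
    (simp add: mat_act_identity assms)

lemma row_equivalent_closed:
  assumes "row_equivalent R M m x z" "\<And>k. k < m \<Longrightarrow> x k \<in> carrier M" "k < m"
  shows "z k \<in> carrier M"
proof -
  obtain P where "P \<in> invertible_matrices R m" "\<forall>i<m. z i = mat_act M P x i"
    using assms(1) unfolding row_equivalent_def by blast
  then show ?thesis
    using mat_act_closed[of P m m x k] assms(2,3) by (auto simp: invertible_matrices_def)
qed

lemma row_equivalent_trans:
  assumes "row_equivalent R M m x y" "row_equivalent R M m y z"
    and "\<And>k. k < m \<Longrightarrow> x k \<in> carrier M"
  shows "row_equivalent R M m x z"
proof -
  obtain P where P: "P \<in> invertible_matrices R m" "P \<in> matrices R m m"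
    "\<And>i. i < m \<Longrightarrow> y i = mat_act M P x i"
    using assms(1) unfolding row_equivalent_def invertible_matrices_def by blast
  obtain Q where Q: "Q \<in> invertible_matrices R m" "Q \<in> matrices R m m"
    "\<And>i. i < m \<Longrightarrow> z i = mat_act M Q y i"
    using assms(2) unfolding row_equivalent_def invertible_matrices_def by blast
  have "z i = mat_act M (matrix_mult R Q P) x i" if "i < m" for i
  proof -
    have "z i = mat_act M Q (mat_act M P x) i"
      using Q(3)[OF that] mat_act_cong[OF Q(2), of "mat_act M P x" y i]
        mat_act_closed[OF P(2) assms(3)] P(3) that by simp
    then show ?thesis
      using mat_act_mult[OF Q(2) P(2) assms(3) that] by simp
  qed
  then show ?thesis
    unfolding row_equivalent_def using R.matrix_mult_invertible[OF Q(1) P(1)] by blast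
qed

lemma row_equivalent_sym:
  assumes "row_equivalent R M m x z" "\<And>k. k < m \<Longrightarrow> x k \<in> carrier M"
  shows "row_equivalent R M m z x"
proof -
  obtain P where P: "P \<in> invertible_matrices R m" "\<And>i. i < m \<Longrightarrow> z i = mat_act M P x i"
    using assms(1) unfolding row_equivalent_def by blast
  obtain P' where P': "P \<in> matrices R m m" "P' \<in> invertible_matrices R m" "P' \<in> matrices R m m"
    "matrix_mult R P' P = identity_matrix R m"
    by (rule R.invertible_matricesE[OF P(1)])
  have "x i = mat_act M P' z i" if "i < m" for i
  proof -
    have "mat_act M P' z i = mat_act M P' (mat_act M P x) i"
      using mat_act_closed[OF P'(1) assms(2)] P(2) that by (intro mat_act_cong[OF P'(3)]) auto
    also have "\<dots> = mat_act M (matrix_mult R P' P) x i"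
      using mat_act_mult[OF P'(3,1) assms(2) that] by simp
    also have "\<dots> = x i"
      unfolding P'(4) using mat_act_identity[of m x i] assms(2) that by simp
    finally show ?thesis by simp
  qed
  then show ?thesis
    unfolding row_equivalent_def using P'(2) by blast
qed

lemma row_equivalent_span_subset:
  assumes "row_equivalent R M m x z" "\<And>k. k < m \<Longrightarrow> x k \<in> carrier M"
  shows "module_span R M (z ` {..<m}) \<subseteq> module_span R M (x ` {..<m})"
proof -
  obtain P where P: "P \<in> matrices R m m" "\<And>i. i < m \<Longrightarrow> z i = mat_act M P x i"
    using assms(1) unfolding row_equivalent_def invertible_matrices_def by blast
  note D = R.matricesD[OF P(1)]
  have span: "module_span R M (x ` {..<m}) = {lincomb M m r x | r. \<forall>k<m. r k \<in> carrier R}"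
    using assms(2) by (rule span_family)
  have "z i \<in> module_span R M (x ` {..<m})" if "i < m" for i
    unfolding span P(2)[OF that] mat_act_def D(2)
    using D(3)[OF that] by blast
  moreover have "x ` {..<m} \<subseteq> carrier M"
    using assms(2) by auto
  ultimately show ?thesis
    by (intro span_subset_span) auto
qed

lemma row_equivalent_span:
  assumes "row_equivalent R M m x z" "\<And>k. k < m \<Longrightarrow> x k \<in> carrier M"
  shows "module_span R M (z ` {..<m}) = module_span R M (x ` {..<m})"
proof (rule equalityI)
  show "module_span R M (z ` {..<m}) \<subseteq> module_span R M (x ` {..<m})"
    using assms by (rule row_equivalent_span_subset)
  show "module_span R M (x ` {..<m}) \<subseteq> module_span R M (z ` {..<m})"
    using row_equivalent_sym[OF assms] row_equivalent_closed[OF assms]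
    by (rule row_equivalent_span_subset)
qed

lemma row_equivalent_replace:
  assumes "\<And>k. k < m \<Longrightarrow> x k \<in> carrier M" "\<And>k. k < m \<Longrightarrow> c k \<in> carrier R"
    and "i < m" "c i \<in> Units R"
  shows "row_equivalent R M m x (x(i := lincomb M m c x))"
  unfolding row_equivalent_def
  using R.elementary_matrix_invertible[of m c i] mat_act_elementary[of m c x _ i] assms
  by (intro bexI[of _ "elementary_matrix m i c"]) auto

lemma lincomb_multiples:
  assumes "\<And>k. k < m \<Longrightarrow> b k \<in> carrier R" "\<And>k. k < m \<Longrightarrow> c k \<in> carrier R" "y \<in> carrier M"
  shows "lincomb M m b (\<lambda>k. c k \<odot>\<^bsub>M\<^esub> y) = lincomb (regular_module R) m b c \<odot>\<^bsub>M\<^esub> y"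
proof -
  interpret Reg: left_module R "regular_module R"
    by (rule left_module_regular) (rule R.ring_axioms)
  have "lincomb (regular_module R) m b c \<in> carrier R"
    using Reg.lincomb_closed[of m b c] assms(1,2) by simp
  moreover have "lincomb M m b (\<lambda>k. c k \<odot>\<^bsub>M\<^esub> y)
      = lincomb M m b (\<lambda>k. lincomb M (Suc 0) (\<lambda>_. c k) (\<lambda>_. y))"
    using assms by (intro lincomb_cong) (simp_all add: lincomb_1)
  ultimately show ?thesis
    using lincomb_lincomb[of m b "Suc 0" "\<lambda>k _. c k" "\<lambda>_. y"] assms by (simp add: lincomb_1)
qed

text \<open>
  Write \<open>y\<close> in terms of the family \<open>x\<close>, and each \<open>x k\<close> as a multiple \<open>c k\<close> of \<open>y\<close> plus a combination
  of the other elements of \<open>Y\<close>.  This expresses \<open>(1 - s) y\<close> by the other elements of \<open>Y\<close>, where \<open>s\<close> is the sum of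
  the \<open>b k * c k\<close>.  As \<open>y\<close> is not redundant, \<open>1 - s\<close> is not left invertible, so some coefficient \<open>b j\<close>
  is a unit and \<open>x j\<close> can be exchanged for \<open>y\<close>.  At positions in \<open>J\<close>, which hold other
  elements of \<open>Y\<close> already, \<open>c\<close> is chosen zero; since \<open>c j\<close> is nonzero, the exchange spares them.
\<close>

lemma exchange_step:
  assumes "left_local R" "\<And>k. k < m \<Longrightarrow> x k \<in> carrier M" "Y \<subseteq> carrier M"
    and "module_span R M (x ` {..<m}) = module_span R M Y"
    and "y \<in> Y" "y \<notin> module_span R M (Y - {y})"
    and "x ` J \<subseteq> Y - {y}"
  obtains j where "j < m" "j \<notin> J" "row_equivalent R M m x (x(j := y))"
proof -
  let ?W = "module_span R M (Y - {y})"
  have YW: "Y - {y} \<subseteq> carrier M" and y: "y \<in> carrier M"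
    using assms(3,5) by auto
  note W = submodule_facts[OF submodule_span[OF YW]]
  interpret Reg: left_module R "regular_module R"
    by (rule left_module_regular) (rule R.ring_axioms)
  have "y \<in> module_span R M (x ` {..<m})"
    unfolding assms(4) using assms(5) span_superset by blast
  moreover have "module_span R M (x ` {..<m}) = {lincomb M m r x | r. \<forall>k<m. r k \<in> carrier R}"
    using assms(2) by (rule span_family)
  ultimately obtain b where b: "\<And>k. k < m \<Longrightarrow> b k \<in> carrier R" "y = lincomb M m b x"
    by blast
  have "\<exists>c w. c \<in> carrier R \<and> w \<in> ?W \<and> x k = c \<odot>\<^bsub>M\<^esub> y \<oplus>\<^bsub>M\<^esub> w \<and> (k \<in> J \<longrightarrow> c = \<zero>)"
    if k: "k < m" for k
  proof (cases "k \<in> J")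
    case True
    then have "x k \<in> ?W"
      using assms(7) span_superset[of "Y - {y}"] by blast
    moreover have "x k = \<zero> \<odot>\<^bsub>M\<^esub> y \<oplus>\<^bsub>M\<^esub> x k"
      using y assms(2)[OF k] by simp
    ultimately show ?thesis
      using R.zero_closed by blast
  next
    case False
    have "x k \<in> module_span R M (x ` {..<m})"
      using k span_superset[of "x ` {..<m}"] by blast
    then have "x k \<in> module_span R M (insert y (Y - {y}))"
      unfolding assms(4) using assms(5) by (simp add: insert_absorb)
    then obtain c w where "c \<in> carrier R" "w \<in> ?W" "x k = c \<odot>\<^bsub>M\<^esub> y \<oplus>\<^bsub>M\<^esub> w"
      by (rule span_insert[OF y YW])
    then show ?thesis
      using False by blast
  qed
  then obtain c w where c: "\<And>k. k < m \<Longrightarrow> c k \<in> carrier R"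
    and w: "\<And>k. k < m \<Longrightarrow> w k \<in> ?W"
    and xk: "\<And>k. k < m \<Longrightarrow> x k = c k \<odot>\<^bsub>M\<^esub> y \<oplus>\<^bsub>M\<^esub> w k"
    and cJ: "\<And>k. k < m \<Longrightarrow> k \<in> J \<Longrightarrow> c k = \<zero>"
    by metis
  have wM: "w k \<in> carrier M" if "k < m" for k
    using w[OF that] W(1) by blast
  let ?s = "lincomb (regular_module R) m b c"
  have s: "?s \<in> carrier R"
    using Reg.lincomb_closed[of m b c] b(1) c by simp
  have bw: "lincomb M m b w \<in> ?W"
    by (rule submodule_lincomb[OF submodule_span[OF YW] b(1) w])
  have "y = lincomb M m b (\<lambda>k. c k \<odot>\<^bsub>M\<^esub> y \<oplus>\<^bsub>M\<^esub> w k)"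
    using b(1) c y wM xk by (subst b(2), intro lincomb_cong) auto
  also have "\<dots> = lincomb M m b (\<lambda>k. c k \<odot>\<^bsub>M\<^esub> y) \<oplus>\<^bsub>M\<^esub> lincomb M m b w"
    using b(1) c y wM by (simp add: lincomb_add_vectors)
  also have "lincomb M m b (\<lambda>k. c k \<odot>\<^bsub>M\<^esub> y) = ?s \<odot>\<^bsub>M\<^esub> y"
    using b(1) c y by (rule lincomb_multiples)
  finally have ysw: "y = ?s \<odot>\<^bsub>M\<^esub> y \<oplus>\<^bsub>M\<^esub> lincomb M m b w" .
  have "(\<one> \<ominus> ?s) \<odot>\<^bsub>M\<^esub> y = y \<oplus>\<^bsub>M\<^esub> \<ominus>\<^bsub>M\<^esub> (?s \<odot>\<^bsub>M\<^esub> y)"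
    using s y by (simp add: R.minus_eq smult_l_distr smult_l_minus)
  also have "\<dots> = (lincomb M m b w \<oplus>\<^bsub>M\<^esub> ?s \<odot>\<^bsub>M\<^esub> y) \<oplus>\<^bsub>M\<^esub> \<ominus>\<^bsub>M\<^esub> (?s \<odot>\<^bsub>M\<^esub> y)"
    using ysw s y bw W(1) M.a_comm[of "?s \<odot>\<^bsub>M\<^esub> y" "lincomb M m b w"] by auto
  also have "\<dots> = lincomb M m b w"
    using s y bw W(1) by (simp add: M.a_assoc M.r_neg subset_iff)
  finally have split: "(\<one> \<ominus> ?s) \<odot>\<^bsub>M\<^esub> y = lincomb M m b w" .
  have no_inverse: "\<not> (\<exists>u\<in>carrier R. u \<otimes> (\<one> \<ominus> ?s) = \<one>)"
  proof
    assume "\<exists>u\<in>carrier R. u \<otimes> (\<one> \<ominus> ?s) = \<one>"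
    then obtain u where u: "u \<in> carrier R" "u \<otimes> (\<one> \<ominus> ?s) = \<one>" by blast
    have "u \<odot>\<^bsub>M\<^esub> ((\<one> \<ominus> ?s) \<odot>\<^bsub>M\<^esub> y) = y"
      using u s y by (simp add: smult_assoc1[symmetric])
    then show False
      using W(4)[OF u(1) bw] assms(6) split by simp
  qed
  obtain j where j: "j < m" "b j \<in> Units R" "c j \<noteq> \<zero>"
    using R.left_local_products[of m b c] assms(1) b(1) c no_inverse by blast
  have "row_equivalent R M m x (x(j := y))"
    using row_equivalent_replace[of m x b j] assms(2) b j(1,2) by simp
  then show ?thesis
    using that j cJ by blast
qed

lemma exchange_into_family:
  assumes "left_local R" "\<And>k. k < m \<Longrightarrow> x k \<in> carrier M" "Y \<subseteq> carrier M"
    and "module_span R M (x ` {..<m}) = module_span R M Y"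
    and "\<And>y. y \<in> Y \<Longrightarrow> y \<notin> module_span R M (Y - {y})"
    and "finite Y'" "Y' \<subseteq> Y"
  shows "\<exists>z J. row_equivalent R M m x z \<and> J \<subseteq> {..<m} \<and> z ` J = Y'"
  using assms(6,7)
proof (induction Y')
  case empty
  show ?case
    using row_equivalent_refl[of m x, OF assms(2)] by (intro exI[of _ x] exI[of _ "{}"]) simp
next
  case (insert y Y')
  then obtain z J where z: "row_equivalent R M m x z" "J \<subseteq> {..<m}" "z ` J = Y'"
    by blast
  note zc = row_equivalent_closed[OF z(1) assms(2)]
  have "module_span R M (z ` {..<m}) = module_span R M Y"
    using row_equivalent_span[OF z(1) assms(2)] assms(4) by simp
  moreover have "y \<in> Y" "y \<notin> module_span R M (Y - {y})" "z ` J \<subseteq> Y - {y}"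
    using insert assms(5)[of y] z(3) by auto
  ultimately obtain j where j: "j < m" "j \<notin> J" "row_equivalent R M m z (z(j := y))"
    using exchange_step[of m z Y y J thesis] assms(1,3) zc by blast
  have "(z(j := y)) ` insert j J = insert y Y'"
    using j(2) z(3) by auto
  moreover have "row_equivalent R M m x (z(j := y))"
    by (rule row_equivalent_trans[OF z(1) j(3) assms(2)])
  moreover have "insert j J \<subseteq> {..<m}"
    using j(1) z(2) by simp
  ultimately show ?case
    by blast
qed

text \<open>
  Once the entries at \<open>J\<close> generate, each of the other entries is a combination of the rest of the
  family and can be reduced to zero.
\<close>

lemma row_equivalent_clear:
  assumes "\<And>k. k < m \<Longrightarrow> x k \<in> carrier M" "J \<subseteq> {..<m}"
    and "x ` {..<m} \<subseteq> module_span R M (x ` J)"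
    and "finite D" "D \<subseteq> {..<m} - J"
  shows "row_equivalent R M m x (\<lambda>k. if k \<in> D then \<zero>\<^bsub>M\<^esub> else x k)"
  using assms(4,5)
proof (induction D)
  case empty
  show ?case
    using row_equivalent_refl[of m x, OF assms(1)] by simp
next
  case (insert i D)
  let ?z = "\<lambda>k. if k \<in> D then \<zero>\<^bsub>M\<^esub> else x k"
  let ?z' = "\<lambda>k. if k \<in> insert i D then \<zero>\<^bsub>M\<^esub> else x k"
  have i: "i < m" "i \<notin> J" "i \<notin> D"
    using insert by auto
  have z: "?z k \<in> carrier M" "?z' k \<in> carrier M" if "k < m" for k
    using assms(1) that by auto
  have "x ` J \<subseteq> ?z' ` {..<m}"
  proof
    fix y assume "y \<in> x ` J"
    then obtain j where "j \<in> J" "y = x j" by blast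
    moreover from this have "j \<notin> insert i D"
      using insert.prems by blast
    ultimately show "y \<in> ?z' ` {..<m}"
      using assms(2) by (intro image_eqI[of _ _ j]) auto
  qed
  moreover have "?z' ` {..<m} \<subseteq> carrier M"
    by (rule image_subsetI, rule z(2)) simp
  ultimately have "module_span R M (x ` J) \<subseteq> module_span R M (?z' ` {..<m})"
    by (intro span_mono)
  moreover have "x i \<in> module_span R M (x ` J)"
    using assms(3) i(1) by auto
  ultimately have "x i \<in> module_span R M (?z' ` {..<m})"
    by (rule subsetD)
  moreover have "module_span R M (?z' ` {..<m}) = {lincomb M m r ?z' | r. \<forall>k<m. r k \<in> carrier R}"
    using z(2) by (rule span_family)
  ultimately obtain r where r: "\<And>k. k < m \<Longrightarrow> r k \<in> carrier R" "x i = lincomb M m r ?z'"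
    by blast
  \<comment> \<open>Position \<open>i\<close> of \<open>?z'\<close> is zero, so \<open>x i\<close> is a combination in which it has coefficient zero.\<close>
  let ?r = "\<lambda>k. if k = i then \<zero> else r k"
  let ?c = "\<lambda>k. if k = i then \<one> else \<ominus> r k"
  have c: "?c k \<in> carrier R" if "k < m" for k
    using r(1) that by simp
  have xi: "x i = lincomb M m ?r ?z"
    unfolding r(2) lincomb_def using r(1) z i(1) assms(1) by (intro M.finsum_cong') auto
  have "lincomb M m ?c ?z = \<one> \<odot>\<^bsub>M\<^esub> ?z i \<oplus>\<^bsub>M\<^esub> lincomb M m (\<lambda>k. if k = i then \<zero> else ?c k) ?z"
    using lincomb_split_at[of i m ?c ?z] i(1) c z(1) by simp
  also have "lincomb M m (\<lambda>k. if k = i then \<zero> else ?c k) ?z = lincomb M m (\<lambda>k. \<ominus> ?r k) ?z"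
    using r(1) z(1) by (intro lincomb_cong) (simp_all split: if_splits)
  also have "\<one> \<odot>\<^bsub>M\<^esub> ?z i = x i"
    using i assms(1) by simp
  also have "lincomb M m (\<lambda>k. \<ominus> ?r k) ?z = \<ominus>\<^bsub>M\<^esub> lincomb M m ?r ?z"
    using r(1) z(1) by (intro lincomb_minus) simp_all
  also have "x i \<oplus>\<^bsub>M\<^esub> \<ominus>\<^bsub>M\<^esub> lincomb M m ?r ?z = \<zero>\<^bsub>M\<^esub>"
    unfolding xi[symmetric] using assms(1)[OF i(1)] by (rule M.r_neg)
  finally have "?z(i := lincomb M m ?c ?z) = ?z'"
    by auto
  then have "row_equivalent R M m ?z ?z'"
    using row_equivalent_replace[of m ?z ?c i] z(1) c i(1) by simp
  moreover have "row_equivalent R M m x ?z"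
    using insert.IH insert.prems by blast
  ultimately show ?case
    using row_equivalent_trans[of m x ?z ?z'] assms(1) by blast
qed

lemma irredundant_generators_exist:
  assumes "finite S" "S \<subseteq> carrier M"
  obtains Y where "Y \<subseteq> S" "module_span R M Y = module_span R M S"
    "\<And>y. y \<in> Y \<Longrightarrow> y \<notin> module_span R M (Y - {y})"
proof -
  let ?P = "\<lambda>Y. Y \<subseteq> S \<and> module_span R M Y = module_span R M S"
  obtain Y where Y: "?P Y" "\<And>Z. ?P Z \<Longrightarrow> card Y \<le> card Z"
    using ex_has_least_nat[of ?P S card] by blast
  have "y \<notin> module_span R M (Y - {y})" if y: "y \<in> Y" for y
  proof
    assume red: "y \<in> module_span R M (Y - {y})"
    have "Y \<subseteq> carrier M" "Y - {y} \<subseteq> carrier M"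
      using Y(1) assms(2) by auto
    moreover have "Y \<subseteq> module_span R M (Y - {y})"
      using red span_superset[of "Y - {y}"] by blast
    ultimately have "module_span R M (Y - {y}) = module_span R M Y"
      by (intro equalityI span_subset_span span_mono) auto
    then have "card Y \<le> card (Y - {y})"
      using Y by blast
    then show False
      using y Y(1) assms(1) card_Diff1_less[of Y y] finite_subset by fastforce
  qed
  then show ?thesis
    using that Y(1) by blast
qed

text \<open>
  An irredundant part of \<open>S\<close> is exchanged into the family, and the remaining entries are cleared.
\<close>

lemma exchange_generators:
  assumes "left_local R" "\<And>k. k < m \<Longrightarrow> x k \<in> carrier M" "finite S" "S \<subseteq> carrier M"
    and "module_span R M (x ` {..<m}) = module_span R M S"
  shows "\<exists>z. row_equivalent R M m x z \<and> (\<forall>k<m. z k \<in> insert \<zero>\<^bsub>M\<^esub> S)"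
proof -
  obtain Y where Y: "Y \<subseteq> S" "module_span R M Y = module_span R M S"
    "\<And>y. y \<in> Y \<Longrightarrow> y \<notin> module_span R M (Y - {y})"
    by (rule irredundant_generators_exist[OF assms(3,4)]) blast
  have Yc: "Y \<subseteq> carrier M" "finite Y"
    using Y(1) assms(3,4) finite_subset by auto
  have "module_span R M (x ` {..<m}) = module_span R M Y"
    using assms(5) Y(2) by simp
  with assms(1,2) Yc(1)
  have "\<exists>z J. row_equivalent R M m x z \<and> J \<subseteq> {..<m} \<and> z ` J = Y"
    using Y(3) Yc(2) order_refl by (rule exchange_into_family)
  then obtain z J where z: "row_equivalent R M m x z" "J \<subseteq> {..<m}" "z ` J = Y"
    by blast
  have zc: "\<And>k. k < m \<Longrightarrow> z k \<in> carrier M"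
    using row_equivalent_closed[OF z(1) assms(2)] .
  have "module_span R M (z ` {..<m}) = module_span R M (z ` J)"
    using row_equivalent_span[OF z(1) assms(2)] assms(5) Y(2) z(3) by simp
  then have "z ` {..<m} \<subseteq> module_span R M (z ` J)"
    using span_superset[of "z ` {..<m}"] by simp
  then have "row_equivalent R M m z (\<lambda>k. if k \<in> {..<m} - J then \<zero>\<^bsub>M\<^esub> else z k)"
    using row_equivalent_clear[of m z J "{..<m} - J"] zc z(2) by simp
  then have "row_equivalent R M m x (\<lambda>k. if k \<in> {..<m} - J then \<zero>\<^bsub>M\<^esub> else z k)"
    by (rule row_equivalent_trans[OF z(1) _ assms(2)])
  moreover have "\<forall>k<m. (if k \<in> {..<m} - J then \<zero>\<^bsub>M\<^esub> else z k) \<in> insert \<zero>\<^bsub>M\<^esub> S"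
    using z(3) Y(1) by auto
  ultimately show ?thesis
    by (intro exI conjI)
qed

end

section \<open>Relation matrices of families\<close>

text \<open>
  The rows of \<open>A\<close> are relations of the family \<open>x\<close>, and they generate all relations.  In contrast to the
  lists of a minimal basis, \<open>x\<close> may have repetitions and zero entries, as they arise from
  \<open>exchange_generators\<close>.
\<close>

definition relation_matrix ::
  "('a, 'c) ring_scheme \<Rightarrow> ('a, 'b, 'd) module_scheme \<Rightarrow> nat \<Rightarrow> nat \<Rightarrow> 'a mat \<Rightarrow> (nat \<Rightarrow> 'b) \<Rightarrow> bool"
  where "relation_matrix R M u v A x \<longleftrightarrow>
    A \<in> matrices R u v \<and> (\<forall>k<v. x k \<in> carrier M) \<and>
    (\<forall>i<u. mat_act M A x i = \<zero>\<^bsub>M\<^esub>) \<and>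
    (\<forall>s. (\<forall>k<v. s k \<in> carrier R) \<longrightarrow> lincomb M v s x = \<zero>\<^bsub>M\<^esub> \<longrightarrow>
      (\<exists>t. (\<forall>i<u. t i \<in> carrier R) \<and>
        (\<forall>k<v. s k = lincomb (regular_module R) u t (\<lambda>i. A $$ (i, k)))))"

lemma relation_matrixD:
  assumes "relation_matrix R M u v A x"
  shows "A \<in> matrices R u v" "\<And>k. k < v \<Longrightarrow> x k \<in> carrier M"
    "\<And>i. i < u \<Longrightarrow> mat_act M A x i = \<zero>\<^bsub>M\<^esub>"
  using assms by (simp_all add: relation_matrix_def)

lemma relation_matrixE:
  assumes "relation_matrix R M u v A x"
    and "\<And>k. k < v \<Longrightarrow> s k \<in> carrier R" "lincomb M v s x = \<zero>\<^bsub>M\<^esub>"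
  obtains t where "\<And>i. i < u \<Longrightarrow> t i \<in> carrier R"
    "\<And>k. k < v \<Longrightarrow> s k = lincomb (regular_module R) u t (\<lambda>i. A $$ (i, k))"
  using assms unfolding relation_matrix_def by blast

lemma relationship_matrix_index:
  "i < length rs \<Longrightarrow> j < length gs \<Longrightarrow> relationship_matrix gs rs $$ (i, j) = rs ! i $ j"
  by (simp add: relationship_matrix_def mat_of_rows_index)

context left_module
begin

lemma relation_matrix_relationship_matrix:
  assumes "set gs \<subseteq> carrier M" "relationship_set R M gs rs"
  shows "relation_matrix R M (length rs) (length gs) (relationship_matrix gs rs) ((!) gs)"
proof -
  let ?u = "length rs" and ?v = "length gs" and ?A = "relationship_matrix gs rs"
  let ?F = "free_module R ?v"
  interpret F: left_module R ?F
    by (rule left_module_free) (rule R.ring_axioms)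
  have rs: "set rs \<subseteq> carrier ?F" "module_span R ?F (set rs) = relationship_submodule R M gs"
    using assms(2) by (auto simp: relationship_set_def generates_def)
  have g: "gs ! k \<in> carrier M" if "k < ?v" for k
    using assms(1) that by auto
  have rsc: "rs ! i \<in> carrier ?F" if "i < ?u" for i
    using rs(1) that by auto
  have dims: "dim_row ?A = ?u" "dim_col ?A = ?v"
    by (simp_all add: relationship_matrix_def)
  have A: "?A \<in> matrices R ?u ?v"
    using dims rsc by (intro matricesI) (auto simp: relationship_matrix_index free_module_simps)
  have act: "mat_act M ?A ((!) gs) i = presentation_map M gs (rs ! i)" if "i < ?u" for i
    unfolding mat_act_def presentation_map_def dims(2)
    using g rsc[OF that] that by (intro lincomb_cong) (auto simp: relationship_matrix_index free_module_simps)
  have "mat_act M ?A ((!) gs) i = \<zero>\<^bsub>M\<^esub>" if "i < ?u" for i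
  proof -
    have "rs ! i \<in> relationship_submodule R M gs"
      using F.span_superset[of "set rs"] rs(2) that by auto
    then show ?thesis
      using act[OF that] by (simp add: relationship_submodule_kernel)
  qed
  moreover have "\<exists>t. (\<forall>i<?u. t i \<in> carrier R) \<and>
      (\<forall>k<?v. s k = lincomb (regular_module R) ?u t (\<lambda>i. ?A $$ (i, k)))"
    if s: "\<forall>k<?v. s k \<in> carrier R" "lincomb M ?v s ((!) gs) = \<zero>\<^bsub>M\<^esub>" for s
  proof -
    have "lincomb M ?v (($) (vec ?v s)) ((!) gs) = lincomb M ?v s ((!) gs)"
      using s(1) g by (intro lincomb_cong) auto
    then have "vec ?v s \<in> relationship_submodule R M gs"
      using s by (simp add: relationship_submodule_kernel presentation_map_def free_module_simps)
    moreover have "relationship_submodule R M gs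
        = {lincomb ?F ?u t ((!) rs) | t. \<forall>i<?u. t i \<in> carrier R}"
    proof -
      have "set rs = (!) rs ` {..<?u}"
        by (auto simp: set_conv_nth)
      then show ?thesis
        using F.span_family[of ?u "(!) rs"] rsc rs(2) by simp
    qed
    ultimately obtain t where t: "\<forall>i<?u. t i \<in> carrier R" "vec ?v s = lincomb ?F ?u t ((!) rs)"
      by blast
    interpret Reg: left_module R "regular_module R"
      by (rule left_module_regular) (rule R.ring_axioms)
    have "s k = lincomb (regular_module R) ?u t (\<lambda>i. ?A $$ (i, k))" if k: "k < ?v" for k
    proof -
      have "s k = lincomb ?F ?u t ((!) rs) $ k"
        using t(2)[symmetric] k by simp
      also have "\<dots> = lincomb (regular_module R) ?u t (\<lambda>i. rs ! i $ k)"
        using t(1) rsc k by (intro R.lincomb_free_index) auto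
      also have "\<dots> = lincomb (regular_module R) ?u t (\<lambda>i. ?A $$ (i, k))"
        using t(1) rsc k R.matricesD(3)[OF A]
        by (intro Reg.lincomb_cong) (auto simp: relationship_matrix_index)
      finally show ?thesis .
    qed
    then show ?thesis
      using t(1) by blast
  qed
  ultimately show ?thesis
    unfolding relation_matrix_def using A g by blast
qed

text \<open>
  A relation \<open>s\<close> of \<open>z = T x\<close> gives the relation \<open>s T\<close> of \<open>x\<close>, a combination of rows of \<open>A\<close>, and
  \<open>s = s T Q\<close>.
\<close>

lemma relation_matrix_base_change:
  assumes "relation_matrix R M u v A x"
    and "Q \<in> matrices R v v" "T \<in> matrices R v v"
    and "matrix_mult R Q T = identity_matrix R v" "matrix_mult R T Q = identity_matrix R v"
    and "\<And>j. j < v \<Longrightarrow> z j = mat_act M T x j"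
  shows "relation_matrix R M u v (matrix_mult R A Q) z"
proof -
  interpret Reg: left_module R "regular_module R"
    by (rule left_module_regular) (rule R.ring_axioms)
  note A = relation_matrixD[OF assms(1)]
  have AQ: "matrix_mult R A Q \<in> matrices R u v"
    by (rule R.matrix_mult_closed[OF A(1) assms(2)])
  have z: "z j \<in> carrier M" if "j < v" for j
    using mat_act_closed[OF assms(3) A(2) that] assms(6)[OF that] by simp
  have Qz: "mat_act M Q z j = x j" if "j < v" for j
  proof -
    have "mat_act M Q z j = mat_act M Q (mat_act M T x) j"
      using mat_act_closed[OF assms(3) A(2)] assms(6) that by (intro mat_act_cong[OF assms(2)]) auto
    also have "\<dots> = mat_act M (matrix_mult R Q T) x j"
      using mat_act_mult[OF assms(2,3) A(2) that] by simp
    also have "\<dots> = x j"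
      unfolding assms(4) using mat_act_identity[of v x j] A(2) that by simp
    finally show ?thesis .
  qed
  have "mat_act M (matrix_mult R A Q) z i = \<zero>\<^bsub>M\<^esub>" if "i < u" for i
  proof -
    have "mat_act M (matrix_mult R A Q) z i = mat_act M A (mat_act M Q z) i"
      by (rule mat_act_mult[OF A(1) assms(2) z that])
    also have "\<dots> = mat_act M A x i"
      using A(2) Qz that by (intro mat_act_cong[OF A(1)]) auto
    finally show ?thesis
      using A(3)[OF that] by simp
  qed
  moreover have "\<exists>t. (\<forall>i<u. t i \<in> carrier R) \<and>
      (\<forall>k<v. s k = lincomb (regular_module R) u t (\<lambda>i. matrix_mult R A Q $$ (i, k)))"
    if s: "\<forall>k<v. s k \<in> carrier R" "lincomb M v s z = \<zero>\<^bsub>M\<^esub>" for s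
  proof -
    \<comment> \<open>\<open>?s\<close> is the row \<open>s T\<close>.\<close>
    let ?s = "\<lambda>k. lincomb (regular_module R) v s (\<lambda>i. T $$ (i, k))"
    have sc: "?s k \<in> carrier R" if "k < v" for k
      using Reg.lincomb_closed[of v s "\<lambda>i. T $$ (i, k)"] s(1) R.matricesD(3)[OF assms(3)] that
      by simp
    have "lincomb M v ?s x = lincomb M v s (mat_act M T x)"
      using lincomb_mat_act[OF assms(3) A(2), where s = s] s(1) by simp
    also have "\<dots> = lincomb M v s z"
      using s(1) z assms(6) by (intro lincomb_cong) auto
    finally have "lincomb M v ?s x = \<zero>\<^bsub>M\<^esub>"
      using s(2) by simp
    then obtain t where t: "\<And>i. i < u \<Longrightarrow> t i \<in> carrier R"
      "\<And>k. k < v \<Longrightarrow> ?s k = lincomb (regular_module R) u t (\<lambda>i. A $$ (i, k))"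
      using relation_matrixE[OF assms(1), of ?s] sc by blast
    have "s k = lincomb (regular_module R) u t (\<lambda>i. matrix_mult R A Q $$ (i, k))" if k: "k < v" for k
    proof -
      let ?q = "\<lambda>i. Q $$ (i, k)"
      have q: "?q i \<in> carrier (regular_module R)" if "i < v" for i
        using R.matricesD(3)[OF assms(2) that k] by simp
      have "lincomb (regular_module R) u t (\<lambda>i. matrix_mult R A Q $$ (i, k))
          = lincomb (regular_module R) u t (mat_act (regular_module R) A ?q)"
        using t(1) R.matrix_mult_index[OF A(1) assms(2) _ k] Reg.mat_act_closed[OF A(1) q]
        by (intro Reg.lincomb_cong) auto
      also have "\<dots> = lincomb (regular_module R) v ?s ?q"
        using Reg.lincomb_mat_act[OF A(1) q, where s = t] t q sc by (auto intro!: Reg.lincomb_cong)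
      also have "\<dots> = lincomb (regular_module R) v s (mat_act (regular_module R) T ?q)"
        using Reg.lincomb_mat_act[OF assms(3) q, where s = s] s(1) by simp
      also have "\<dots> = lincomb (regular_module R) v (\<lambda>i. if i = k then s k else \<zero>) (\<lambda>_. \<one>)"
        unfolding lincomb_def
      proof (rule Reg.M.finsum_cong')
        fix i assume "i \<in> {..<v}"
        then have i: "i < v" by simp
        have "mat_act (regular_module R) T ?q i = (if i = k then \<one> else \<zero>)"
          using R.matrix_mult_index[OF assms(3,2) i k] i k unfolding assms(5)
          by (simp add: identity_matrix_def)
        then show "s i \<odot>\<^bsub>regular_module R\<^esub> mat_act (regular_module R) T ?q i
            = (if i = k then s k else \<zero>) \<odot>\<^bsub>regular_module R\<^esub> \<one>"
          using s(1) i by simp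
      qed (use s(1) k in auto)
      also have "\<dots> = s k"
        using Reg.lincomb_single[of k v "s k" "\<lambda>_. \<one>"] s(1) k by simp
      finally show ?thesis by simp
    qed
    then show ?thesis
      using t(1) by blast
  qed
  ultimately show ?thesis
    unfolding relation_matrix_def using AQ z by blast
qed

text \<open>
  With \<open>P'\<close> the inverse of \<open>P\<close>, a combination \<open>t A\<close> of the rows of \<open>A\<close> is the combination
  \<open>(t P') (P A)\<close> of the rows of \<open>P A\<close>.
\<close>

lemma relation_matrix_row_change:
  assumes "relation_matrix R M u v A x" "P \<in> invertible_matrices R u"
  shows "relation_matrix R M u v (matrix_mult R P A) x"
proof -
  interpret Reg: left_module R "regular_module R"
    by (rule left_module_regular) (rule R.ring_axioms)
  note A = relation_matrixD[OF assms(1)]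
  obtain P' where P: "P \<in> matrices R u u" "P' \<in> matrices R u u"
    "matrix_mult R P' P = identity_matrix R u"
    by (rule R.invertible_matricesE[OF assms(2)])
  have PA: "matrix_mult R P A \<in> matrices R u v"
    by (rule R.matrix_mult_closed[OF P(1) A(1)])
  have "mat_act M (matrix_mult R P A) x i = \<zero>\<^bsub>M\<^esub>" if "i < u" for i
  proof -
    have "mat_act M (matrix_mult R P A) x i = mat_act M P (mat_act M A x) i"
      by (rule mat_act_mult[OF P(1) A(1,2) that])
    also have "\<dots> = \<zero>\<^bsub>M\<^esub>"
      unfolding mat_act_def[of _ P] R.matricesD(2)[OF P(1)]
      using A(3) R.matricesD(3)[OF P(1) that] by (intro lincomb_eq_zero) simp
    finally show ?thesis .
  qed
  moreover have "\<exists>t. (\<forall>i<u. t i \<in> carrier R) \<and>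
      (\<forall>k<v. s k = lincomb (regular_module R) u t (\<lambda>i. matrix_mult R P A $$ (i, k)))"
    if s: "\<forall>k<v. s k \<in> carrier R" "lincomb M v s x = \<zero>\<^bsub>M\<^esub>" for s
  proof -
    obtain t where t: "\<And>i. i < u \<Longrightarrow> t i \<in> carrier R"
      "\<And>k. k < v \<Longrightarrow> s k = lincomb (regular_module R) u t (\<lambda>i. A $$ (i, k))"
      using relation_matrixE[OF assms(1), of s] s by blast
    \<comment> \<open>\<open>?t\<close> is the row \<open>t P'\<close>.\<close>
    let ?t = "\<lambda>l. lincomb (regular_module R) u t (\<lambda>i. P' $$ (i, l))"
    have "?t l \<in> carrier R" if "l < u" for l
      using Reg.lincomb_closed[of u t "\<lambda>i. P' $$ (i, l)"] t(1) R.matricesD(3)[OF P(2)] that by simp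
    moreover have "s k = lincomb (regular_module R) u ?t (\<lambda>i. matrix_mult R P A $$ (i, k))"
      if k: "k < v" for k
    proof -
      let ?b = "\<lambda>i. matrix_mult R P A $$ (i, k)"
      have b: "?b i \<in> carrier (regular_module R)" if "i < u" for i
        using R.matricesD(3)[OF PA that k] by simp
      have "lincomb (regular_module R) u ?t ?b
          = lincomb (regular_module R) u t (mat_act (regular_module R) P' ?b)"
        using Reg.lincomb_mat_act[OF P(2) b, where s = t] t(1) by simp
      also have "\<dots> = lincomb (regular_module R) u t (\<lambda>i. A $$ (i, k))"
      proof (rule Reg.lincomb_cong)
        fix i assume i: "i < u"
        have "matrix_mult R P' (matrix_mult R P A) = A"
          using R.matrix_mult_assoc[OF P(2,1) A(1)] R.matrix_mult_identity_left[OF A(1)] P(3) by simp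
        then show "mat_act (regular_module R) P' ?b i = A $$ (i, k)"
          using R.matrix_mult_index[OF P(2) PA i k] by simp
        show "A $$ (i, k) \<in> carrier (regular_module R)"
          using R.matricesD(3)[OF A(1) i k] by simp
      qed (use t(1) in simp_all)
      finally show ?thesis
        using t(2)[OF k] by simp
    qed
    ultimately show ?thesis
      by (intro exI[of _ ?t] conjI allI impI)
  qed
  ultimately show ?thesis
    unfolding relation_matrix_def using PA A(2) by blast
qed

end

section \<open>Blocks\<close>

text \<open>
  The bound makes the maximum that defines the block number one over a finite set.
\<close>

lemma has_disjoint_blocks_le:
  assumes "has_disjoint_blocks R A t" shows "t \<le> dim_col A"
proof -
  obtain C where C: "disjoint_family_on C {..<t}" "\<And>k. k < t \<Longrightarrow> is_block R A (C k)"
    using assms unfolding has_disjoint_blocks_def by blast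
  have "\<forall>k. k < t \<longrightarrow> (\<exists>j. j \<in> C k)"
    using C(2) unfolding is_block_def by blast
  then obtain f where f: "\<And>k. k < t \<Longrightarrow> f k \<in> C k"
    by metis
  have "inj_on f {..<t}"
  proof (rule inj_onI)
    fix k l assume "k \<in> {..<t}" "l \<in> {..<t}" "f k = f l"
    then have "f k \<in> C k \<inter> C l"
      using f[of k] f[of l] by simp
    then show "k = l"
      using C(1) \<open>k \<in> {..<t}\<close> \<open>l \<in> {..<t}\<close> unfolding disjoint_family_on_def by blast
  qed
  moreover have "f ` {..<t} \<subseteq> {..<dim_col A}"
    using f C(2) unfolding is_block_def by blast
  ultimately show ?thesis
    using card_inj_on_le[of f "{..<t}" "{..<dim_col A}"] by simp
qed

lemma block_number_ge_2_iff:
  "2 \<le> block_number R A \<longleftrightarrow> (\<exists>C D. C \<inter> D = {} \<and> is_block R A C \<and> is_block R A D)"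
proof -
  let ?T = "{t. has_disjoint_blocks R A t}"
  have "finite ?T"
    using has_disjoint_blocks_le[of R A] by (intro finite_subset[of ?T "{..dim_col A}"]) auto
  moreover have "0 \<in> ?T"
    by (simp add: has_disjoint_blocks_def disjoint_family_on_def)
  ultimately have "2 \<le> block_number R A \<longleftrightarrow> (\<exists>t\<in>?T. 2 \<le> t)"
    unfolding block_number_def by (intro Max_ge_iff) auto
  also have "\<dots> \<longleftrightarrow> (\<exists>C D. C \<inter> D = {} \<and> is_block R A C \<and> is_block R A D)"
  proof
    assume "\<exists>t\<in>?T. 2 \<le> t"
    then obtain t :: nat and C where t: "2 \<le> t" and C: "disjoint_family_on C {..<t}"
      "\<forall>k<t. is_block R A (C k)"
      unfolding has_disjoint_blocks_def by blast
    have "C 0 \<inter> C 1 = {}"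
      using C(1) t by (auto simp: disjoint_family_on_def)
    moreover have "is_block R A (C 0)" "is_block R A (C 1)"
      using C(2) t by auto
    ultimately show "\<exists>C D. C \<inter> D = {} \<and> is_block R A C \<and> is_block R A D"
      by blast
  next
    assume "\<exists>C D. C \<inter> D = {} \<and> is_block R A C \<and> is_block R A D"
    then obtain C D where CD: "C \<inter> D = {}" "is_block R A C" "is_block R A D"
      by blast
    have "has_disjoint_blocks R A 2"
      unfolding has_disjoint_blocks_def
    proof (intro exI conjI allI impI)
      show "disjoint_family_on (\<lambda>k. if k = 0 then C else D) {..<2::nat}"
        using CD(1) by (auto simp: disjoint_family_on_def less_2_cases_iff)
      show "is_block R A (if k = 0 then C else D)" for k :: nat
        using CD by simp
    qed
    then show "\<exists>t\<in>?T. 2 \<le> t"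
      by blast
  qed
  finally show ?thesis .
qed

context left_module
begin

lemma lincomb_restrict:
  assumes "\<And>k. k < n \<Longrightarrow> r k \<in> carrier R" "\<And>k. k < n \<Longrightarrow> x k \<in> carrier M"
  shows "lincomb M n r x = lincomb M n (\<lambda>k. if k \<in> C then r k else \<zero>) x
    \<oplus>\<^bsub>M\<^esub> lincomb M n (\<lambda>k. if k \<in> C then \<zero> else r k) x"
proof -
  have "lincomb M n r x
      = lincomb M n (\<lambda>k. (if k \<in> C then r k else \<zero>) \<oplus> (if k \<in> C then \<zero> else r k)) x"
    using assms by (intro lincomb_cong) auto
  also have "\<dots> = lincomb M n (\<lambda>k. if k \<in> C then r k else \<zero>) x
      \<oplus>\<^bsub>M\<^esub> lincomb M n (\<lambda>k. if k \<in> C then \<zero> else r k) x"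
    using assms by (intro lincomb_add) auto
  finally show ?thesis .
qed

text \<open>
  In a direct sum, the \<open>H\<close>-part and the \<open>K\<close>-part of a relation are relations.
\<close>

lemma lincomb_restrict_zero:
  assumes "submodule H R M" "submodule K R M" "H \<inter> K = {\<zero>\<^bsub>M\<^esub>}"
    and "\<And>k. k < n \<Longrightarrow> k \<in> C \<Longrightarrow> x k \<in> H" "\<And>k. k < n \<Longrightarrow> k \<notin> C \<Longrightarrow> x k \<in> K"
    and "\<And>k. k < n \<Longrightarrow> r k \<in> carrier R" "lincomb M n r x = \<zero>\<^bsub>M\<^esub>"
  shows "lincomb M n (\<lambda>k. if k \<in> C then r k else \<zero>) x = \<zero>\<^bsub>M\<^esub>"
    and "lincomb M n (\<lambda>k. if k \<in> C then \<zero> else r k) x = \<zero>\<^bsub>M\<^esub>"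
proof -
  note H = submodule_facts[OF assms(1)] and K = submodule_facts[OF assms(2)]
  have x: "x k \<in> carrier M" if "k < n" for k
    using assms(4)[OF that] assms(5)[OF that] H(1) K(1) by (cases "k \<in> C") auto
  let ?h = "lincomb M n (\<lambda>k. if k \<in> C then r k else \<zero>) x"
  let ?k = "lincomb M n (\<lambda>k. if k \<in> C then \<zero> else r k) x"
  have "?h = lincomb M n (\<lambda>k. if k \<in> C then r k else \<zero>) (\<lambda>k. if k \<in> C then x k else \<zero>\<^bsub>M\<^esub>)"
    unfolding lincomb_def using assms(6) x by (intro M.finsum_cong') auto
  also have "\<dots> \<in> H"
    using assms(4,6) H(2) by (intro submodule_lincomb[OF assms(1)]) auto
  finally have h: "?h \<in> H" .
  have "?k = lincomb M n (\<lambda>k. if k \<in> C then \<zero> else r k) (\<lambda>k. if k \<in> C then \<zero>\<^bsub>M\<^esub> else x k)"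
    unfolding lincomb_def using assms(6) x by (intro M.finsum_cong') auto
  also have "\<dots> \<in> K"
    using assms(5,6) K(2) by (intro submodule_lincomb[OF assms(2)]) auto
  finally have k: "?k \<in> K" .
  have sum: "?h \<oplus>\<^bsub>M\<^esub> ?k = \<zero>\<^bsub>M\<^esub>"
    using lincomb_restrict[of n r x C] assms(6,7) x by simp
  have c: "?h \<in> carrier M" "?k \<in> carrier M"
    using h k H(1) K(1) by auto
  have "?h = \<ominus>\<^bsub>M\<^esub> ?k"
    using M.minus_equality[OF sum c(2,1)] by simp
  then have "?h \<in> K"
    using K(5)[OF k] by simp
  then show "?h = \<zero>\<^bsub>M\<^esub>"
    using h assms(3) by blast
  then show "?k = \<zero>\<^bsub>M\<^esub>"
    using sum c by simp
qed

section \<open>Decomposable modules have blockable matrices\<close>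

text \<open>
  The rows of \<open>A\<close>, as vectors in \<open>R\<^sup>v\<close>, have the same span as their restrictions to \<open>C\<close> and to the
  complement of \<open>C\<close>, because these restrictions are relations again.  The exchange lemma in \<open>R\<^sup>v\<close> then turns the rows into
  such restrictions and zeros.
\<close>

lemma block_rows_exist:
  assumes "left_local R" "relation_matrix R M u v A z"
    and "submodule H R M" "submodule K R M" "H \<inter> K = {\<zero>\<^bsub>M\<^esub>}"
    and "\<And>k. k < v \<Longrightarrow> k \<in> C \<Longrightarrow> z k \<in> H" "\<And>k. k < v \<Longrightarrow> k \<notin> C \<Longrightarrow> z k \<in> K"
  obtains P where "P \<in> invertible_matrices R u"
    "\<And>i. i < u \<Longrightarrow> (\<forall>k<v. k \<notin> C \<longrightarrow> matrix_mult R P A $$ (i, k) = \<zero>) \<or>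
      (\<forall>k<v. k \<in> C \<longrightarrow> matrix_mult R P A $$ (i, k) = \<zero>)"
proof -
  let ?F = "free_module R v"
  interpret F: left_module R ?F
    by (rule left_module_free) (rule R.ring_axioms)
  interpret Reg: left_module R "regular_module R"
    by (rule left_module_regular) (rule R.ring_axioms)
  note A = relation_matrixD[OF assms(2)]
  note D = R.matricesD[OF A(1)]
  define row where "row i = vec v (\<lambda>k. A $$ (i, k))" for i
  define inC where "inC i = vec v (\<lambda>k. if k \<in> C then A $$ (i, k) else \<zero>)" for i
  define offC where "offC i = vec v (\<lambda>k. if k \<in> C then \<zero> else A $$ (i, k))" for i
  let ?S = "inC ` {..<u} \<union> offC ` {..<u}"
  have closed: "row i \<in> carrier ?F" "inC i \<in> carrier ?F" "offC i \<in> carrier ?F" if "i < u" for i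
    using D(3)[OF that] by (auto simp: row_def inC_def offC_def free_module_simps)
  have rows_c: "row ` {..<u} \<subseteq> carrier ?F" and S: "finite ?S" "?S \<subseteq> carrier ?F"
    using closed by auto
  have rowspan: "module_span R ?F (row ` {..<u}) = {lincomb ?F u t row | t. \<forall>i<u. t i \<in> carrier R}"
    using closed(1) by (rule F.span_family)
  have relation_in_rowspan: "vec v s \<in> module_span R ?F (row ` {..<u})"
    if s: "\<And>k. k < v \<Longrightarrow> s k \<in> carrier R" "lincomb M v s z = \<zero>\<^bsub>M\<^esub>" for s
  proof -
    obtain t where t: "\<And>i. i < u \<Longrightarrow> t i \<in> carrier R"
      "\<And>k. k < v \<Longrightarrow> s k = lincomb (regular_module R) u t (\<lambda>i. A $$ (i, k))"
      using relation_matrixE[OF assms(2), of s] s by blast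
    have "vec v s = lincomb ?F u t row"
    proof (rule eq_vecI)
      have "lincomb ?F u t row \<in> carrier ?F"
        using t(1) closed(1) by (rule F.lincomb_closed)
      then have "lincomb ?F u t row \<in> carrier_vec v"
        by (simp add: free_module_simps)
      then show dim: "dim_vec (vec v s) = dim_vec (lincomb ?F u t row)"
        by simp
      fix k assume "k < dim_vec (lincomb ?F u t row)"
      then have k: "k < v"
        using dim by simp
      have "lincomb ?F u t row $ k = lincomb (regular_module R) u t (\<lambda>i. row i $ k)"
        using t(1) closed(1) k by (rule R.lincomb_free_index)
      then show "vec v s $ k = lincomb ?F u t row $ k"
        using t(2)[OF k] k by (simp add: row_def)
    qed
    then show ?thesis
      unfolding rowspan using t(1) by blast
  qed
  have act: "lincomb M v (\<lambda>k. A $$ (i, k)) z = \<zero>\<^bsub>M\<^esub>" if "i < u" for i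
    using A(3)[OF that] unfolding mat_act_def D(2) .
  have "inC i \<in> module_span R ?F (row ` {..<u})" "offC i \<in> module_span R ?F (row ` {..<u})"
    if i: "i < u" for i
  proof -
    have r: "\<And>k. k < v \<Longrightarrow> A $$ (i, k) \<in> carrier R"
      using D(3)[OF i] .
    have inC0: "lincomb M v (\<lambda>k. if k \<in> C then A $$ (i, k) else \<zero>) z = \<zero>\<^bsub>M\<^esub>"
      using assms(3-7) r act[OF i] by (rule lincomb_restrict_zero(1))
    have offC0: "lincomb M v (\<lambda>k. if k \<in> C then \<zero> else A $$ (i, k)) z = \<zero>\<^bsub>M\<^esub>"
      using assms(3-7) r act[OF i] by (rule lincomb_restrict_zero(2))
    show "inC i \<in> module_span R ?F (row ` {..<u})"
      unfolding inC_def using r inC0 by (intro relation_in_rowspan) auto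
    show "offC i \<in> module_span R ?F (row ` {..<u})"
      unfolding offC_def using r offC0 by (intro relation_in_rowspan) auto
  qed
  then have "module_span R ?F ?S \<subseteq> module_span R ?F (row ` {..<u})"
    by (intro F.span_subset_span[OF rows_c]) auto
  moreover have "module_span R ?F (row ` {..<u}) \<subseteq> module_span R ?F ?S"
  proof (rule F.span_subset_span[OF S(2)], rule image_subsetI)
    fix i assume "i \<in> {..<u}"
    then have i: "i < u" by simp
    have "inC i \<in> module_span R ?F ?S" "offC i \<in> module_span R ?F ?S"
      by (rule subsetD[OF F.span_superset], use i in simp)+
    then have "inC i \<oplus>\<^bsub>?F\<^esub> offC i \<in> module_span R ?F ?S"
      by (rule F.submodule_add[OF F.submodule_span[OF S(2)]])
    moreover have "inC i \<oplus>\<^bsub>?F\<^esub> offC i = row i"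
      using D(3)[OF i] by (auto simp: row_def inC_def offC_def free_module_simps)
    ultimately show "row i \<in> module_span R ?F ?S"
      by simp
  qed
  ultimately have span: "module_span R ?F (row ` {..<u}) = module_span R ?F ?S"
    by simp
  have "\<exists>w. row_equivalent R ?F u row w \<and> (\<forall>i<u. w i \<in> insert \<zero>\<^bsub>?F\<^esub> ?S)"
    using assms(1) closed(1) S span by (rule F.exchange_generators)
  then obtain w where w: "row_equivalent R ?F u row w"
    and wS: "\<And>i. i < u \<Longrightarrow> w i \<in> insert \<zero>\<^bsub>?F\<^esub> ?S"
    by blast
  obtain P where P: "P \<in> invertible_matrices R u" "P \<in> matrices R u u"
    and wP: "\<And>i. i < u \<Longrightarrow> w i = mat_act ?F P row i"
    using w unfolding row_equivalent_def invertible_matrices_def by blast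
  have entry: "matrix_mult R P A $$ (i, k) = w i $ k" if i: "i < u" and k: "k < v" for i k
  proof -
    note DP = R.matricesD[OF P(2)]
    have "w i $ k = lincomb (regular_module R) u (\<lambda>j. P $$ (i, j)) (\<lambda>j. row j $ k)"
      using R.lincomb_free_index[of u "\<lambda>j. P $$ (i, j)" row v k] DP(3)[OF i] closed(1) k
      by (simp add: wP[OF i] mat_act_def DP(2))
    also have "\<dots> = mat_act (regular_module R) P (\<lambda>j. A $$ (j, k)) i"
      using k by (simp add: row_def mat_act_def DP(2))
    finally show ?thesis
      using R.matrix_mult_index[OF P(2) A(1) i k] by simp
  qed
  have "(\<forall>k<v. k \<notin> C \<longrightarrow> matrix_mult R P A $$ (i, k) = \<zero>) \<or>
      (\<forall>k<v. k \<in> C \<longrightarrow> matrix_mult R P A $$ (i, k) = \<zero>)" if i: "i < u" for i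
  proof -
    have "w i = \<zero>\<^bsub>?F\<^esub> \<or> (\<exists>j. w i = inC j) \<or> (\<exists>j. w i = offC j)"
      using wS[OF i] by blast
    then consider "w i = \<zero>\<^bsub>?F\<^esub>" | j where "w i = inC j" | j where "w i = offC j"
      by blast
    then show ?thesis
      using entry[OF i] by cases (simp_all add: inC_def offC_def free_module_simps)
  qed
  then show ?thesis
    using that P(1) by blast
qed

text \<open>
  The exchange lemma is used twice: in \<open>M\<close> for the generators and, through \<open>block_rows_exist\<close>, in a free
  module for the relations.  Both sides of the partition of the columns are nonempty since neither
  \<open>H\<close> nor \<open>K\<close> is all of \<open>M\<close>.
\<close>

lemma decomposable_imp_blockable:
  assumes "left_local R" "relation_matrix R M u v A x"
    and "module_span R M (x ` {..<v}) = carrier M" "\<not> indecomposable R M"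
  shows "blockable R A"
proof -
  note A = relation_matrixD[OF assms(2)]
  obtain H K where HK: "submodule H R M" "submodule K R M" "H <+>\<^bsub>M\<^esub> K = carrier M"
    "H \<inter> K = {\<zero>\<^bsub>M\<^esub>}" "H \<noteq> {\<zero>\<^bsub>M\<^esub>}" "K \<noteq> {\<zero>\<^bsub>M\<^esub>}"
    using assms(4) unfolding indecomposable_def by blast
  note H = submodule_facts[OF HK(1)] and K = submodule_facts[OF HK(2)]
  have "\<exists>h k. h \<in> H \<and> k \<in> K \<and> x i = h \<oplus>\<^bsub>M\<^esub> k" if "i < v" for i
  proof -
    have "x i \<in> H <+>\<^bsub>M\<^esub> K"
      using A(2)[OF that] HK(3) by simp
    then show ?thesis
      unfolding set_add_def set_mult_def by auto
  qed
  then obtain h k where hk: "\<And>i. i < v \<Longrightarrow> h i \<in> H" "\<And>i. i < v \<Longrightarrow> k i \<in> K"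
    "\<And>i. i < v \<Longrightarrow> x i = h i \<oplus>\<^bsub>M\<^esub> k i"
    by metis
  let ?S = "h ` {..<v} \<union> k ` {..<v}"
  have S: "finite ?S" "?S \<subseteq> carrier M" "?S \<subseteq> H \<union> K"
    using hk H(1) K(1) by auto
  have "x i \<in> module_span R M ?S" if "i < v" for i
  proof -
    have "h i \<in> module_span R M ?S" "k i \<in> module_span R M ?S"
      by (rule subsetD[OF span_superset], use that in simp)+
    then have "h i \<oplus>\<^bsub>M\<^esub> k i \<in> module_span R M ?S"
      by (rule submodule_add[OF submodule_span[OF S(2)]])
    then show ?thesis
      using hk(3)[OF that] by simp
  qed
  then have "module_span R M (x ` {..<v}) \<subseteq> module_span R M ?S"
    by (intro span_subset_span[OF S(2)]) auto
  moreover have "module_span R M ?S \<subseteq> carrier M"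
    by (rule submodule_subset[OF submodule_span[OF S(2)]])
  ultimately have span: "module_span R M (x ` {..<v}) = module_span R M ?S"
    using assms(3) by simp
  have "\<exists>z. row_equivalent R M v x z \<and> (\<forall>j<v. z j \<in> insert \<zero>\<^bsub>M\<^esub> ?S)"
    using assms(1) A(2) S(1,2) span by (rule exchange_generators)
  then obtain z where z: "row_equivalent R M v x z"
    and zS: "\<And>j. j < v \<Longrightarrow> z j \<in> insert \<zero>\<^bsub>M\<^esub> ?S"
    by blast
  have zHK: "z j \<in> H \<union> K" if "j < v" for j
  proof (rule subsetD[OF _ zS[OF that]])
    show "insert \<zero>\<^bsub>M\<^esub> ?S \<subseteq> H \<union> K"
      using S(3) H(2) by (simp only: insert_subset Un_iff simp_thms)
  qed
  have zspan: "module_span R M (z ` {..<v}) = carrier M"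
    using row_equivalent_span[OF z A(2)] assms(3) by simp
  obtain T where T: "T \<in> invertible_matrices R v" "\<And>j. j < v \<Longrightarrow> z j = mat_act M T x j"
    using z unfolding row_equivalent_def by blast
  obtain Q where Q: "T \<in> matrices R v v" "Q \<in> invertible_matrices R v" "Q \<in> matrices R v v"
    "matrix_mult R T Q = identity_matrix R v" "matrix_mult R Q T = identity_matrix R v"
    by (rule R.invertible_matricesE[OF T(1)])
  have AQ: "relation_matrix R M u v (matrix_mult R A Q) z"
    by (rule relation_matrix_base_change[OF assms(2) Q(3,1,5,4) T(2)])
  let ?C = "{j. j < v \<and> z j \<in> H}" and ?D = "{j. j < v \<and> z j \<notin> H}"
  obtain P where P: "P \<in> invertible_matrices R u"
    and rows: "\<And>i. i < u \<Longrightarrow> (\<forall>j<v. j \<notin> ?C \<longrightarrow> matrix_mult R P (matrix_mult R A Q) $$ (i, j) = \<zero>) \<or>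
      (\<forall>j<v. j \<in> ?C \<longrightarrow> matrix_mult R P (matrix_mult R A Q) $$ (i, j) = \<zero>)"
  proof (rule block_rows_exist[OF assms(1) AQ HK(1,2,4), of ?C])
    show "z j \<in> K" if "j < v" "j \<notin> ?C" for j
      using zHK that by blast
  qed auto
  let ?B = "matrix_mult R P (matrix_mult R A Q)"
  have Pm: "P \<in> matrices R u u"
    using P by (simp add: invertible_matrices_def)
  have B: "?B = matrix_mult R (matrix_mult R P A) Q" "?B \<in> matrices R u v"
    using R.matrix_mult_assoc[OF Pm A(1) Q(3)]
      R.matrix_mult_closed[OF Pm R.matrix_mult_closed[OF A(1) Q(3)]] by simp_all
  have "?C \<noteq> {}"
  proof
    assume "?C = {}"
    then have "z ` {..<v} \<subseteq> K"
      using zHK by blast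
    then have "H \<subseteq> K"
      using span_least[OF HK(2)] zspan H(1) by blast
    then show False
      using HK(4,5) by blast
  qed
  moreover have "?D \<noteq> {}"
  proof
    assume "?D = {}"
    then have "z ` {..<v} \<subseteq> H"
      by blast
    then have "K \<subseteq> H"
      using span_least[OF HK(1)] zspan K(1) by blast
    then show False
      using HK(4,6) by blast
  qed
  ultimately have blocks: "is_block R ?B ?C" "is_block R ?B ?D"
    unfolding is_block_def using R.matricesD(1,2)[OF B(2)] rows by auto
  have "?C \<inter> ?D = {}"
    by blast
  then have "2 \<le> block_number R ?B"
    unfolding block_number_ge_2_iff using blocks by (intro exI conjI)
  moreover have "equivalent_matrices R A ?B"
    unfolding equivalent_matrices_def
    by (intro exI[of _ u] exI[of _ v] conjI bexI[OF _ P] bexI[OF _ Q(2)] A(1) B)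
  ultimately show ?thesis
    unfolding blockable_def by blast
qed

section \<open>Blocks decompose modules\<close>

text \<open>
  Since each row of \<open>B\<close> vanishes on \<open>C\<close> or off \<open>C\<close>, restricting a relation of \<open>z\<close> to \<open>C\<close> gives a
  relation.  Hence the combinations of the \<open>z j\<close> with \<open>j \<in> C\<close> and the combinations of the others meet in
  zero only.  If one of these submodules were zero, the other part of \<open>z\<close> would generate \<open>M\<close>.
\<close>

lemma block_imp_decomposable:
  assumes "relation_matrix R M u v B z" "is_block R B C"
    and "module_span R M (z ` {..<v}) = carrier M"
    and "\<And>S. S \<subset> {..<v} \<Longrightarrow> module_span R M (z ` S) \<noteq> carrier M"
    and "\<not> {..<v} \<subseteq> C"
  shows "\<not> indecomposable R M"
proof -
  note B = relation_matrixD[OF assms(1)]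
  note D = R.matricesD[OF B(1)]
  interpret Reg: left_module R "regular_module R"
    by (rule left_module_regular) (rule R.ring_axioms)
  have C: "C \<noteq> {}" "C \<subseteq> {..<v}"
    using assms(2) D(2) by (auto simp: is_block_def)
  let ?supp = "\<lambda>X. {lincomb M v r z | r. \<forall>k<v. r k \<in> carrier R \<and> (k \<notin> X \<longrightarrow> r k = \<zero>)}"
  have sub: "submodule (?supp X) R M" for X
    using B(2) by (rule submodule_lincombs_supported)
  have restrict_relation: "lincomb M v (\<lambda>k. if k \<in> C then s k else \<zero>) z = \<zero>\<^bsub>M\<^esub>"
    if s: "\<And>k. k < v \<Longrightarrow> s k \<in> carrier R" "lincomb M v s z = \<zero>\<^bsub>M\<^esub>" for s
  proof -
    obtain t where t: "\<And>i. i < u \<Longrightarrow> t i \<in> carrier R"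
      "\<And>k. k < v \<Longrightarrow> s k = lincomb (regular_module R) u t (\<lambda>i. B $$ (i, k))"
      using relation_matrixE[OF assms(1), of s] s by blast
    let ?B = "\<lambda>i k. if k \<in> C then B $$ (i, k) else \<zero>"
    have Bc: "?B i k \<in> carrier R" if "i < u" "k < v" for i k
      using D(3) that by simp
    have row: "lincomb M v (?B i) z = \<zero>\<^bsub>M\<^esub>" if i: "i < u" for i
    proof (cases "\<exists>k\<in>C. B $$ (i, k) \<noteq> \<zero>")
      case True
      then have "\<forall>k<v. k \<notin> C \<longrightarrow> B $$ (i, k) = \<zero>"
        using assms(2) i D(1,2) by (auto simp: is_block_def)
      then have "lincomb M v (?B i) z = mat_act M B z i"
        unfolding mat_act_def D(2) using D(3)[OF i] B(2) by (intro lincomb_cong) auto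
      then show ?thesis
        using B(3)[OF i] by simp
    next
      case False
      then show ?thesis
        using B(2) by (intro lincomb_eq_zero) auto
    qed
    have "lincomb M v (\<lambda>k. if k \<in> C then s k else \<zero>) z
        = lincomb M v (\<lambda>k. lincomb (regular_module R) u t (\<lambda>i. ?B i k)) z"
    proof (rule lincomb_cong)
      fix k assume k: "k < v"
      have "lincomb (regular_module R) u t (\<lambda>i. \<zero>) = \<zero>"
        using Reg.lincomb_eq_zero[of u t "\<lambda>i. \<zero>"] t(1) by simp
      then show "(if k \<in> C then s k else \<zero>) = lincomb (regular_module R) u t (\<lambda>i. ?B i k)"
        using t(2)[OF k] by simp
      show "lincomb (regular_module R) u t (\<lambda>i. ?B i k) \<in> carrier R"
        using Reg.lincomb_closed[of u t "\<lambda>i. ?B i k"] t(1) Bc k by simp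
    qed (use B(2) in simp_all)
    also have "\<dots> = lincomb M u t (\<lambda>i. lincomb M v (?B i) z)"
      using lincomb_lincomb[of u t v ?B z] t(1) Bc B(2) by simp
    also have "\<dots> = \<zero>\<^bsub>M\<^esub>"
      using t(1) row by (intro lincomb_eq_zero) simp
    finally show ?thesis .
  qed
  have "?supp C \<inter> ?supp (- C) \<subseteq> {\<zero>\<^bsub>M\<^esub>}"
  proof
    fix y assume "y \<in> ?supp C \<inter> ?supp (- C)"
    then obtain p q where p: "y = lincomb M v p z" "\<forall>k<v. p k \<in> carrier R \<and> (k \<notin> C \<longrightarrow> p k = \<zero>)"
      and q: "y = lincomb M v q z" "\<forall>k<v. q k \<in> carrier R \<and> (k \<notin> - C \<longrightarrow> q k = \<zero>)"
      by blast
    have y: "y \<in> carrier M"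
      unfolding p(1) using p(2) B(2) by (intro lincomb_closed) auto
    let ?s = "\<lambda>k. p k \<oplus> \<ominus> q k"
    have "lincomb M v ?s z = lincomb M v p z \<oplus>\<^bsub>M\<^esub> lincomb M v (\<lambda>k. \<ominus> q k) z"
      using p(2) q(2) B(2) by (intro lincomb_add) auto
    also have "lincomb M v (\<lambda>k. \<ominus> q k) z = \<ominus>\<^bsub>M\<^esub> lincomb M v q z"
      using q(2) B(2) by (intro lincomb_minus) auto
    finally have "lincomb M v ?s z = \<zero>\<^bsub>M\<^esub>"
      unfolding p(1)[symmetric] q(1)[symmetric] using y by (simp add: M.r_neg)
    then have "lincomb M v (\<lambda>k. if k \<in> C then ?s k else \<zero>) z = \<zero>\<^bsub>M\<^esub>"
      using p(2) q(2) by (intro restrict_relation) auto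
    moreover have "lincomb M v (\<lambda>k. if k \<in> C then ?s k else \<zero>) z = y"
      unfolding p(1) using p(2) q(2) B(2) by (intro lincomb_cong) auto
    ultimately show "y \<in> {\<zero>\<^bsub>M\<^esub>}"
      by simp
  qed
  then have inter: "?supp C \<inter> ?supp (- C) = {\<zero>\<^bsub>M\<^esub>}"
    using submodule_zero[OF sub[of C]] submodule_zero[OF sub[of "- C"]] by auto
  have sum: "?supp C <+>\<^bsub>M\<^esub> ?supp (- C) = carrier M"
  proof
    show "?supp C <+>\<^bsub>M\<^esub> ?supp (- C) \<subseteq> carrier M"
      using submodule_subset[OF sub[of C]] submodule_subset[OF sub[of "- C"]]
      unfolding set_add_def set_mult_def by auto
    have span: "module_span R M (z ` {..<v}) = {lincomb M v r z | r. \<forall>k<v. r k \<in> carrier R}"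
      using B(2) by (rule span_family)
    show "carrier M \<subseteq> ?supp C <+>\<^bsub>M\<^esub> ?supp (- C)"
    proof
      fix y assume "y \<in> carrier M"
      then obtain r where r: "y = lincomb M v r z" "\<forall>k<v. r k \<in> carrier R"
        unfolding assms(3)[symmetric] span by blast
      let ?p = "lincomb M v (\<lambda>k. if k \<in> C then r k else \<zero>) z"
      let ?q = "lincomb M v (\<lambda>k. if k \<in> C then \<zero> else r k) z"
      have "?p \<in> ?supp C"
        using r(2) by (intro CollectI exI[of _ "\<lambda>k. if k \<in> C then r k else \<zero>"]) simp
      moreover have "?q \<in> ?supp (- C)"
        using r(2) by (intro CollectI exI[of _ "\<lambda>k. if k \<in> C then \<zero> else r k"]) simp
      moreover have "y = ?p \<oplus>\<^bsub>M\<^esub> ?q"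
        unfolding r(1) using r(2) B(2) by (intro lincomb_restrict) auto
      ultimately show "y \<in> ?supp C <+>\<^bsub>M\<^esub> ?supp (- C)"
        unfolding set_add_def set_mult_def by auto
    qed
  qed
  have nonzero: "?supp X \<noteq> {\<zero>\<^bsub>M\<^esub>}" if X: "X \<noteq> {}" "X \<subseteq> {..<v}" for X
  proof
    assume zero: "?supp X = {\<zero>\<^bsub>M\<^esub>}"
    have zX: "z j = \<zero>\<^bsub>M\<^esub>" if j: "j \<in> X" for j
    proof -
      have "lincomb M v (\<lambda>k. if k = j then \<one> else \<zero>) z \<in> ?supp X"
        using j by (intro CollectI exI[of _ "\<lambda>k. if k = j then \<one> else \<zero>"]) auto
      moreover have "lincomb M v (\<lambda>k. if k = j then \<one> else \<zero>) z = z j"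
        using X(2) j B(2) by (intro lincomb_unit) auto
      ultimately show ?thesis
        using zero by simp
    qed
    let ?W = "module_span R M (z ` ({..<v} - X))"
    have c: "z ` ({..<v} - X) \<subseteq> carrier M"
      using B(2) by auto
    have "z j \<in> ?W" if "j < v" for j
      using zX[of j] submodule_zero[OF submodule_span[OF c]] span_superset[of "z ` ({..<v} - X)"] that
      by (cases "j \<in> X") auto
    then have "module_span R M (z ` {..<v}) \<subseteq> ?W"
      by (intro span_subset_span[OF c]) auto
    then have "?W = carrier M"
      using assms(3) submodule_subset[OF submodule_span[OF c]] by simp
    moreover have "{..<v} - X \<subset> {..<v}"
      using X by auto
    ultimately show False
      using assms(4) by blast
  qed
  have "?supp (- C) = ?supp ({..<v} - C)"
    by (intro Collect_cong ex_cong1) auto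
  then have "?supp C \<noteq> {\<zero>\<^bsub>M\<^esub>}" "?supp (- C) \<noteq> {\<zero>\<^bsub>M\<^esub>}"
    using nonzero[of C] nonzero[of "{..<v} - C"] C assms(5) by auto
  then show ?thesis
    unfolding indecomposable_def using sub inter sum by blast
qed

text \<open>
  The bound \<open>v \<le> card S\<close> ensures that no proper part of the transformed family \<open>Q\<^sup>-\<^sup>1 x\<close> generates \<open>M\<close>.
\<close>

lemma blockable_imp_decomposable:
  assumes "relation_matrix R M u v A x" "module_span R M (x ` {..<v}) = carrier M"
    and "\<And>S. finite S \<Longrightarrow> generates R M (carrier M) S \<Longrightarrow> v \<le> card S"
    and "blockable R A"
  shows "\<not> indecomposable R M"
proof -
  note A = relation_matrixD[OF assms(1)]
  obtain B where B: "equivalent_matrices R A B" "2 \<le> block_number R B"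
    using assms(4) unfolding blockable_def by blast
  then obtain u' v' P Q where PQ: "A \<in> matrices R u' v'" "P \<in> invertible_matrices R u'"
    "Q \<in> invertible_matrices R v'" "B = matrix_mult R (matrix_mult R P A) Q"
    unfolding equivalent_matrices_def by blast
  have uv: "u' = u" "v' = v"
    using R.matricesD(1,2)[OF A(1)] R.matricesD(1,2)[OF PQ(1)] by auto
  obtain T where T: "Q \<in> matrices R v v" "T \<in> invertible_matrices R v" "T \<in> matrices R v v"
    "matrix_mult R Q T = identity_matrix R v" "matrix_mult R T Q = identity_matrix R v"
    using R.invertible_matricesE[OF PQ(3)] unfolding uv by blast
  define z where "z = mat_act M T x"
  have "relation_matrix R M u v (matrix_mult R P A) x"
    using relation_matrix_row_change[OF assms(1)] PQ(2) uv by simp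
  then have rel: "relation_matrix R M u v B z"
    unfolding PQ(4) by (rule relation_matrix_base_change[OF _ T(1,3-5)]) (simp add: z_def)
  have "row_equivalent R M v x z"
    unfolding row_equivalent_def z_def using T(2) by blast
  then have zspan: "module_span R M (z ` {..<v}) = carrier M"
    using row_equivalent_span[of v x z] A(2) assms(2) by simp
  have minimal: "module_span R M (z ` S) \<noteq> carrier M" if S: "S \<subset> {..<v}" for S
  proof
    assume "module_span R M (z ` S) = carrier M"
    then have "generates R M (carrier M) (z ` S)"
      using relation_matrixD(2)[OF rel] S by (auto simp: generates_def)
    moreover have fin: "finite S"
      using S finite_subset by blast
    ultimately have "v \<le> card (z ` S)"
      using assms(3) by blast
    also have "\<dots> \<le> card S"
      using fin by (rule card_image_le)
    also have "\<dots> < v"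
      using psubset_card_mono[OF _ S] by simp
    finally show False by simp
  qed
  obtain C D where CD: "C \<inter> D = {}" "is_block R B C" "is_block R B D"
    using B(2) unfolding block_number_ge_2_iff by blast
  have "D \<noteq> {}" "D \<subseteq> {..<v}"
    using CD(3) R.matricesD(2)[OF relation_matrixD(1)[OF rel]] by (auto simp: is_block_def)
  then have "\<not> {..<v} \<subseteq> C"
    using CD(1) by blast
  with rel CD(2) zspan minimal show ?thesis
    by (rule block_imp_decomposable)
qed

end

section \<open>Indecomposability and inblockable matrices\<close>

theorem theorem2p1:
  fixes R :: "('a, 'c) ring_scheme" and M :: "('a, 'b, 'd) module_scheme"
  assumes "ring R"
    and "left_noetherian R"
    and "unique_minimal_resolutions R"
    and "left_module R M"
    and "fin_gen R M (carrier M)"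
  shows "indecomposable R M \<longleftrightarrow>
    (\<exists>gs rs. minimal_basis R M (carrier M) gs \<and> relationship_set R M gs rs \<and>
      inblockable R (relationship_matrix gs rs))"
proof -
  interpret left_module R M by fact
  have matrix: "relation_matrix R M (length rs) (length gs) (relationship_matrix gs rs) ((!) gs)"
    and span: "module_span R M ((!) gs ` {..<length gs}) = carrier M"
    if "minimal_basis R M (carrier M) gs" "relationship_set R M gs rs" for gs rs
  proof -
    have gs: "set gs \<subseteq> carrier M" "module_span R M (set gs) = carrier M"
      using that(1) by (auto simp: minimal_basis_def generates_def)
    show "relation_matrix R M (length rs) (length gs) (relationship_matrix gs rs) ((!) gs)"
      using gs(1) that(2) by (rule relation_matrix_relationship_matrix)
    have "set gs = (!) gs ` {..<length gs}"
      by (auto simp: set_conv_nth)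
    then show "module_span R M ((!) gs ` {..<length gs}) = carrier M"
      using gs(2) by simp
  qed
  show ?thesis
  proof
    assume indec: "indecomposable R M"
    \<comment> \<open>A minimal basis of least cardinality, so that blocks give nonzero summands.\<close>
    obtain gs where gs: "minimal_basis R M (carrier M) gs"
      "\<And>S. finite S \<Longrightarrow> generates R M (carrier M) S \<Longrightarrow> length gs \<le> card S"
      by (rule minimal_basis_exists[OF assms(5)]) blast
    have "set gs \<subseteq> carrier M"
      using gs(1) by (auto simp: minimal_basis_def generates_def)
    then have "fin_gen R (free_module R (length gs)) (relationship_submodule R M gs)"
      using R.fin_gen_submodule_of_free[OF assms(2)] relationship_submodule_submodule by blast
    then obtain rs where "minimal_basis R (free_module R (length gs)) (relationship_submodule R M gs) rs"
      by (rule left_module.minimal_basis_exists[OF left_module_free[OF assms(1)]])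
    then have rs: "relationship_set R M gs rs"
      by (simp add: relationship_set_def minimal_basis_def)
    have "inblockable R (relationship_matrix gs rs)"
      unfolding inblockable_def
    proof
      assume "blockable R (relationship_matrix gs rs)"
      with matrix[OF gs(1) rs] span[OF gs(1) rs] gs(2) have "\<not> indecomposable R M"
        by (rule blockable_imp_decomposable)
      then show False
        using indec by blast
    qed
    then show "\<exists>gs rs. minimal_basis R M (carrier M) gs \<and> relationship_set R M gs rs \<and>
        inblockable R (relationship_matrix gs rs)"
      using gs(1) rs by blast
  next
    assume "\<exists>gs rs. minimal_basis R M (carrier M) gs \<and> relationship_set R M gs rs \<and>
        inblockable R (relationship_matrix gs rs)"
    then obtain gs rs where gs: "minimal_basis R M (carrier M) gs" "relationship_set R M gs rs"
      "\<not> blockable R (relationship_matrix gs rs)"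
      unfolding inblockable_def by blast
    have "left_local R"
      by (rule R.left_local_if_unique_minimal_resolutions[OF assms(2,3)])
    then show "indecomposable R M"
      using decomposable_imp_blockable[OF _ matrix[OF gs(1,2)] span[OF gs(1,2)]] gs(3) by blast
  qed
qed

end
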